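(* Let $V$ be an admissible $\mathbb{Z}$-set and let $H\in1+\mathrm{Fil}^1C(V,W(\mathbb{C}))[[\underline t_{\mathbb{N}}]]$. Then for every $k\ge1$, $$\Bigl(\prod_VH\Bigr)_k=\prod_{|v|\in|V_{\mathbf k}|}H(|v|)_1(\underline t^{\deg(|v|)})=\prod_{|v|\in|V|}\Bigl(H(|v|)_{k/\gcd(k,\deg(|v|))}\bigl(\underline t^{\deg(|v|)/\gcd(k,\deg(|v|))}\bigr)\Bigr)^{\gcd(k,\deg(|v|))},$$ where in the middle expression $H$ denotes its restriction $H_{V_{\mathbf k}}$ to $V_{\mathbf k}$ and degrees are computed in $V_{\mathbf k}$, and the products on the right are ordinary infinite products of power series in $\mathbb{C}[[\underline t_{\mathbb{N}}]]$.
   Context: **Admissible $\mathbb{Z}$-sets.** An admissible $\mathbb{Z}$-set is a set $V$ with an action of the group $\mathbb{Z}$ such that $V=\bigcup_{k\ge1}V^{k\mathbb{Z}}$ and each $V^{k\mathbb{Z}}$ is finite. $|V|$ is the set of orbits; $\deg(v)=\deg(|v|)$ is the size of the orbit of $v$. $V_{\mathbf k}$ is the set $V$ with the action multiplied by $k$ ($j$ acts as $kj$ did). **Witt vectors.** $W(\mathbb{C})$ is the ring of big Witt vectors. Its additive group is $1+t\mathbb{C}[[t]]$ under multiplication. The ghost components $w_k$ ($k\ge1$) are defined by $t\frac{d}{dt}\log w=\sum_{k\ge1}w_kt^k$, and $w\mapsto(w_k)_k$ is a ring isomorphism $W(\mathbb{C})\cong\prod_{k\ge1}\mathbb{C}$.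 The Adams operations are $p_i\circ(w_k)_k=(w_{ik})_k$. $w(t^i)$ denotes substitution of $t^i$ for $t$ in the power series. **Functions.** $C(V,W(\mathbb{C}))$ is the ring of functions $V\to W(\mathbb{C})$ constant on orbits, with pointwise operations (including Adams operations). $\int_Vf=\sum_{|v|\in|V|}f(|v|)(t^{\deg(|v|)})\in W(\mathbb{C})$ (sum in $W(\mathbb{C})$). For $f\in C(V,W(\mathbb{C}))$, its restriction $f_{V_{\mathbf k}}\in C(V_{\mathbf k},W(\mathbb{C}))$ is $f_{V_{\mathbf k}}(x)=p_{k/\gcd(\deg(x),k)}\circ f(x)$, with $\deg(x)$ computed in $V$. These are applied coefficient-wise to power series. **Power series.** For $R=W(\mathbb{C})$ or $C(V,W(\mathbb{C}))$, $R[[\underline t_{\mathbb{N}}]]=\varprojlim_nR[[t_1,\dots,t_n]]$ carries Adams operations (ring endomorphisms) extending those on $R$ with $p_i\circ t_j=t_j^i$; $\mathrm{Fil}^1$ is the set of series with zero constant term; $\mathrm{Exp}_\sigma(F)=\exp\bigl(\sum_{j\ge1}\frac{p_j\circ F}{j}\bigr)$ is a bijection $\mathrm{Fil}^1\to1+\mathrm{Fil}^1$ with inverse $\mathrm{Log}_\sigma$. For a series $G$ with coefficients in $W(\mathbb{C})$, $G_i\in\mathbb{C}[[\underline t_{\mathbb{N}}]]$ is obtained by taking the $i$th ghost component of every coefficient. $G(\underline t^d)$ denotes substitution of $t_j^d$ for each $t_j$. $H(|v|)$ is the series over $W(\mathbb{C})$ obtained by evaluating the coefficients of $H$ at $|v|$.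 **Motivic Euler product.** $\prod_VH:=\mathrm{Exp}_\sigma\bigl(\int_V\mathrm{Log}_\sigma(H)\bigr)\in W(\mathbb{C})[[\underline t_{\mathbb{N}}]]$. *)

theory Defs
  imports
    "HOL-Algebra.Group_Action"
    "HOL-Algebra.Elementary_Groups"
    "HOL-Analysis.Infinite_Sum"
    "HOL-Library.Function_Algebras"
    "HOL-Library.Poly_Mapping"
begin

section \<open>Coefficient rings: commutative rational algebras with Adams operations\<close>

class adams_ring = comm_ring_1 +
  fixes adams :: "nat \<Rightarrow> 'a \<Rightarrow> 'a"
  assumes of_nat_dvd_1: "n > 0 \<Longrightarrow> of_nat n dvd 1"
    and adams_add: "i > 0 \<Longrightarrow> adams i (x + y) = adams i x + adams i y"
    and adams_mult: "i > 0 \<Longrightarrow> adams i (x * y) = adams i x * adams i y"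
    and adams_one: "i > 0 \<Longrightarrow> adams i 1 = 1"
    and adams_id: "adams 1 x = x"
    and adams_adams: "i > 0 \<Longrightarrow> j > 0 \<Longrightarrow> adams i (adams j x) = adams (i * j) x"

text \<open>\<open>recip n\<close> is \<open>1/n\<close> in such a ring.\<close>

definition recip :: "nat \<Rightarrow> 'a::adams_ring" where
  "recip n = (THE y. of_nat n * y = 1)"

lemma of_nat_mult_recip:
  assumes "n > 0"
  shows "of_nat n * (recip n :: 'a::adams_ring) = 1"
proof -
  obtain y :: 'a where y: "of_nat n * y = 1"
    using of_nat_dvd_1[OF assms] by (metis dvdE)
  have "z = y" if "of_nat n * z = 1" for z :: 'a
    using y that by (metis mult.assoc mult.commute mult_1)
  with y show ?thesis unfolding recip_def by (rule theI)
qed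

text \<open>Functions with values in such a ring, with pointwise operations.\<close>

lemma of_nat_fun_apply: "(of_nat n :: 'a \<Rightarrow> 'b::comm_ring_1) x = of_nat n"
  by (induction n) (auto simp: zero_fun_def one_fun_def)

instantiation "fun" :: (type, adams_ring) adams_ring
begin

definition adams_fun :: "nat \<Rightarrow> ('a \<Rightarrow> 'b) \<Rightarrow> 'a \<Rightarrow> 'b" where
  "adams_fun i f = (\<lambda>x. adams i (f x))"

instance
proof
  fix n :: nat assume n: "n > 0"
  have "(of_nat n :: 'a \<Rightarrow> 'b) * (\<lambda>_. recip n) = 1"
    by (rule ext) (simp add: times_fun_def of_nat_fun_apply of_nat_mult_recip[OF n] one_fun_def)
  thus "(of_nat n :: 'a \<Rightarrow> 'b) dvd 1" by (metis dvd_triv_left)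
qed (simp_all add: adams_fun_def fun_eq_iff plus_fun_def times_fun_def one_fun_def
      adams_add adams_mult adams_one adams_id[unfolded One_nat_def] adams_adams)

end


section \<open>The big Witt vectors of the complex numbers\<close>

unbundle fps_syntax

definition fps_ghost :: "complex fps \<Rightarrow> complex fps" where
  "fps_ghost w = fps_X * fps_deriv (fps_ln 1 oo (w - 1))"

definition fps_of_ghost :: "(nat \<Rightarrow> complex) \<Rightarrow> complex fps" where
  "fps_of_ghost g = fps_exp 1 oo Abs_fps (\<lambda>n. if n = 0 then 0 else g n / of_nat n)"

lemma fps_ln_compose_deriv:
  fixes w :: "complex fps"
  assumes "w $ 0 = 1"
  shows "fps_deriv (fps_ln 1 oo (w - 1)) = inverse w * fps_deriv w"
proof -
  have w0: "(w - 1) $ 0 = 0" using assms by simp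
  have "fps_deriv (fps_ln 1 oo (w - 1)) = (inverse (1 + fps_X) oo (w - 1)) * fps_deriv w"
    using w0 by (simp add: fps_compose_deriv fps_ln_deriv)
  also have "inverse (1 + fps_X) oo (w - 1) = inverse ((1 + fps_X) oo (w - 1))"
    using w0 by (subst fps_inverse_compose) auto
  also have "(1 + fps_X) oo (w - 1) = w"
    using w0 by (simp add: fps_compose_add_distrib)
  finally show ?thesis .
qed

lemma fps_ghost_eq: "w $ 0 = 1 \<Longrightarrow> fps_ghost w = fps_X * fps_deriv w * inverse w"
  by (simp add: fps_ghost_def fps_ln_compose_deriv)

lemma fps_of_ghost_0 [simp]: "fps_of_ghost g $ 0 = 1"
  by (simp add: fps_of_ghost_def)

lemma fps_ghost_of_ghost: "k > 0 \<Longrightarrow> fps_ghost (fps_of_ghost g) $ k = g k"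
proof -
  assume k: "k > 0"
  let ?A = "Abs_fps (\<lambda>n. if n = 0 then 0 else g n / of_nat n)"
  have A0: "?A $ 0 = 0" by simp
  have "fps_deriv (fps_of_ghost g) = fps_of_ghost g * fps_deriv ?A"
    unfolding fps_of_ghost_def using A0 by (simp add: fps_compose_deriv)
  hence "fps_ghost (fps_of_ghost g)
    = fps_X * fps_deriv ?A * (fps_of_ghost g * inverse (fps_of_ghost g))"
    by (simp add: fps_ghost_eq algebra_simps)
  also have "fps_of_ghost g * inverse (fps_of_ghost g) = 1"
    by (metis fps_of_ghost_0 inverse_mult_eq_1' zero_neq_one)
  finally show ?thesis using k by (cases k) (simp_all del: of_nat_Suc)
qed

lemma fps_ghost_inject:
  assumes "v $ 0 = 1" "w $ 0 = 1" "\<And>k. k > 0 \<Longrightarrow> fps_ghost v $ k = fps_ghost w $ k"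
  shows "v = w"
proof -
  have "fps_ghost v = fps_ghost w"
  proof (rule fps_ext)
    fix n show "fps_ghost v $ n = fps_ghost w $ n"
      by (cases "n = 0") (simp add: fps_ghost_def, simp add: assms(3))
  qed
  hence eq: "inverse v * fps_deriv v = inverse w * fps_deriv w"
    unfolding fps_ghost_def fps_ln_compose_deriv[OF assms(1)] fps_ln_compose_deriv[OF assms(2)]
    by simp
  have iv: "v * inverse v = 1" and iw: "w * inverse w = 1"
    using assms(1,2) by (metis inverse_mult_eq_1' zero_neq_one)+
  have "fps_deriv (v * inverse w) = fps_deriv v * inverse w - v * fps_deriv w * (inverse w)\<^sup>2"
    using assms(2) by (simp add: fps_inverse_deriv)
  also have "\<dots> = v * inverse w * (inverse v * fps_deriv v) * 1 - v * inverse w * (inverse w * fps_deriv w)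
     + (1 - v * inverse v) * fps_deriv v * inverse w"
    by (simp add: algebra_simps power2_eq_square)
  also have "\<dots> = 0" by (simp add: iv eq)
  finally have "fps_deriv (v * inverse w) = 0" .
  hence "v * inverse w = fps_const ((v * inverse w) $ 0)"
    by (simp only: fps_deriv_eq_0_iff)
  also have "\<dots> = 1" using assms(1,2) by simp
  finally have "v * inverse w = 1" .
  hence "v * (w * inverse w) = w" by (metis mult.assoc mult.commute mult_1_right)
  thus ?thesis using iw by simp
qed

lemma fps_ghost_mult:
  assumes "v $ 0 = 1" "w $ 0 = 1"
  shows "fps_ghost (v * w) = fps_ghost v + fps_ghost w"
proof -
  have iv: "v * inverse v = 1" and iw: "w * inverse w = 1"
    using assms by (metis inverse_mult_eq_1' zero_neq_one)+
  have vw: "(v * w) $ 0 = 1" using assms by simp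
  have "fps_ghost (v * w) = fps_X * (fps_deriv v * inverse v * (w * inverse w)
      + fps_deriv w * inverse w * (v * inverse v))"
    unfolding fps_ghost_eq[OF vw] fps_inverse_mult by (simp add: algebra_simps)
  thus ?thesis using assms by (simp add: iv iw fps_ghost_eq algebra_simps)
qed

lemma fps_ghost_1 [simp]: "fps_ghost 1 = 0"
  by (simp add: fps_ghost_eq)

typedef witt = "{w :: complex fps. w $ 0 = 1}"
  morphisms witt_fps Abs_witt
  by (rule exI[of _ 1]) simp

definition ghost :: "witt \<Rightarrow> nat \<Rightarrow> complex" where
  "ghost w k = fps_ghost (witt_fps w) $ k"

definition witt_of_ghost :: "(nat \<Rightarrow> complex) \<Rightarrow> witt" where
  "witt_of_ghost g = Abs_witt (fps_of_ghost g)"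

lemma witt_fps_0 [simp]: "witt_fps w $ 0 = 1"
  using witt_fps[of w] by simp

lemma ghost_witt_of_ghost [simp]: "k > 0 \<Longrightarrow> ghost (witt_of_ghost g) k = g k"
  by (simp add: ghost_def witt_of_ghost_def Abs_witt_inverse fps_ghost_of_ghost)

lemma witt_eqI: "(\<And>k. k > 0 \<Longrightarrow> ghost v k = ghost w k) \<Longrightarrow> v = w"
  by (metis fps_ghost_inject ghost_def witt_fps_0 witt_fps_inject)

text \<open>
  Addition is multiplication of power series. The product is the one that makes every ghost
  component multiplicative; over the complex numbers the ghost map is bijective, so this
  determines it.
\<close>

instantiation witt :: comm_ring_1
begin

definition zero_witt :: witt where "0 = Abs_witt 1"
definition plus_witt :: "witt \<Rightarrow> witt \<Rightarrow> witt" where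
  "v + w = Abs_witt (witt_fps v * witt_fps w)"
definition uminus_witt :: "witt \<Rightarrow> witt" where
  "- w = Abs_witt (inverse (witt_fps w))"
definition minus_witt :: "witt \<Rightarrow> witt \<Rightarrow> witt" where
  "v - w = v + (- w :: witt)"
definition one_witt :: witt where "1 = witt_of_ghost (\<lambda>_. 1)"
definition times_witt :: "witt \<Rightarrow> witt \<Rightarrow> witt" where
  "v * w = witt_of_ghost (\<lambda>k. ghost v k * ghost w k)"
lemma ghost_zero [simp]: "ghost 0 k = 0"
  by (simp add: ghost_def zero_witt_def Abs_witt_inverse)

lemma ghost_add [simp]: "ghost (v + w) k = ghost v k + ghost w k"
  by (simp add: ghost_def plus_witt_def Abs_witt_inverse fps_ghost_mult)

lemma ghost_uminus [simp]: "ghost (- w) k = - ghost w k"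
proof -
  have "w + - w = 0"
    by (metis (mono_tags, lifting) Abs_witt_inverse inverse_mult_eq_1' mem_Collect_eq
        fps_inverse_nth_0 inverse_1 plus_witt_def uminus_witt_def witt_fps_0 zero_neq_one zero_witt_def)
  from arg_cong[OF this, of "\<lambda>w. ghost w k"] show ?thesis
    by (simp add: add_eq_0_iff)
qed

lemma ghost_one [simp]: "k > 0 \<Longrightarrow> ghost 1 k = 1"
  by (simp add: one_witt_def)

lemma ghost_mult [simp]: "k > 0 \<Longrightarrow> ghost (v * w) k = ghost v k * ghost w k"
  by (simp add: times_witt_def)

instance
proof (intro_classes, goal_cases)
  case (10)
  have "ghost 0 1 \<noteq> ghost 1 1" by simp
  thus ?case by metis
qed (rule witt_eqI; simp add: algebra_simps minus_witt_def; fail)+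

end

lemma ghost_of_nat [simp]: "k > 0 \<Longrightarrow> ghost (of_nat n) k = of_nat n"
  by (induction n) simp_all

instantiation witt :: adams_ring
begin

definition adams_witt :: "nat \<Rightarrow> witt \<Rightarrow> witt" where
  "adams_witt i w = witt_of_ghost (\<lambda>k. ghost w (i * k))"

lemma ghost_adams [simp]: "k > 0 \<Longrightarrow> ghost (adams i w) k = ghost w (i * k)"
  by (simp add: adams_witt_def)

instance
proof (intro_classes, goal_cases)
  case (1 n)
  have "of_nat n * witt_of_ghost (\<lambda>_. 1 / of_nat n) = (1 :: witt)"
    by (rule witt_eqI) (use 1 in simp)
  thus ?case by (metis dvd_triv_left)
qed (rule witt_eqI; simp add: algebra_simps; fail)+

end

text \<open>The topology of coefficientwise (\<open>t\<close>-adic) convergence, inherited from power series.\<close>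

instantiation witt :: metric_space
begin

definition dist_witt :: "witt \<Rightarrow> witt \<Rightarrow> real" where
  "dist_witt v w = dist (witt_fps v) (witt_fps w)"
definition uniformity_witt :: "(witt \<times> witt) filter" where
  "uniformity_witt = (INF e\<in>{0<..}. principal {(v, w). dist v w < e})"
definition open_witt :: "witt set \<Rightarrow> bool" where
  "open_witt U \<longleftrightarrow> (\<forall>v\<in>U. eventually (\<lambda>(v', w). v' = v \<longrightarrow> w \<in> U) uniformity)"

instance
proof
  fix u v w :: witt
  show "(dist v w = 0) = (v = w)"
    by (simp add: dist_witt_def witt_fps_inject)
  show "dist v w \<le> dist v u + dist w u"
    by (simp add: dist_witt_def dist_triangle2)
qed (simp_all add: uniformity_witt_def open_witt_def)

end

definition witt_subst :: "nat \<Rightarrow> witt \<Rightarrow> witt" where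
  "witt_subst d w = Abs_witt (witt_fps w oo fps_X ^ d)"


section \<open>Power series in countably many variables\<close>

text \<open>
  A monomial in \<open>t\<^sub>1, t\<^sub>2, \<dots>\<close> is a finitely supported exponent vector (the exponent of
  \<open>t\<^bsub>j+1\<^esub>\<close> sits at index \<open>j\<close>). An element of the inverse limit of the rings
  \<open>R[[t\<^sub>1, \<dots>, t\<^sub>n]]\<close> is the same thing as an arbitrary family of coefficients indexed by these
  monomials.
\<close>

typedef 'a mps = "UNIV :: ((nat \<Rightarrow>\<^sub>0 nat) \<Rightarrow> 'a) set"
  morphisms mps_coeff Abs_mps
  by simp

lemma mps_coeff_Abs [simp]: "mps_coeff (Abs_mps f) = f"
  by (simp add: Abs_mps_inverse)

lemma mps_eqI: "(\<And>m. mps_coeff F m = mps_coeff G m) \<Longrightarrow> F = G"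
  by (metis ext mps_coeff_inject)

lemma finite_monomial_splits: "finite {(a, b). a + b = (m :: nat \<Rightarrow>\<^sub>0 nat)}"
proof -
  let ?B = "\<Union>i\<in>Poly_Mapping.keys m. {..Poly_Mapping.lookup m i}"
  let ?S = "{f. \<forall>i. (i \<in> Poly_Mapping.keys m \<longrightarrow> f i \<in> ?B) \<and> (i \<notin> Poly_Mapping.keys m \<longrightarrow> f i = (0::nat))}"
  have "finite ?S" by (rule finite_set_of_finite_funs) auto
  moreover have "Poly_Mapping.lookup ` fst ` {(a, b). a + b = m} \<subseteq> ?S"
    by (auto simp: lookup_add in_keys_iff intro!: bexI)
  ultimately have "finite (Poly_Mapping.lookup ` fst ` {(a, b). a + b = m})" by (rule rev_finite_subset)
  hence "finite (fst ` {(a, b). a + b = m})"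
    by (rule finite_imageD) (simp add: inj_on_def lookup_inject)
  moreover have "inj_on fst {(a, b). a + b = m}" by (auto simp: inj_on_def)
  ultimately show ?thesis by (rule finite_imageD)
qed

instantiation mps :: (comm_ring_1) comm_ring_1
begin

definition zero_mps :: "'a mps" where "0 = Abs_mps (\<lambda>_. 0)"
definition one_mps :: "'a mps" where "1 = Abs_mps (\<lambda>m. if m = 0 then 1 else 0)"
definition plus_mps :: "'a mps \<Rightarrow> 'a mps \<Rightarrow> 'a mps" where
  "F + G = Abs_mps (\<lambda>m. mps_coeff F m + mps_coeff G m)"
definition uminus_mps :: "'a mps \<Rightarrow> 'a mps" where
  "- F = Abs_mps (\<lambda>m. - mps_coeff F m)"
definition minus_mps :: "'a mps \<Rightarrow> 'a mps \<Rightarrow> 'a mps" where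
  "F - G = Abs_mps (\<lambda>m. mps_coeff F m - mps_coeff G m)"
definition times_mps :: "'a mps \<Rightarrow> 'a mps \<Rightarrow> 'a mps" where
  "F * G = Abs_mps (\<lambda>m. \<Sum>(a, b) | a + b = m. mps_coeff F a * mps_coeff G b)"

lemma mps_coeff_simps [simp]:
  "mps_coeff 0 m = (0::'a)"
  "mps_coeff 1 m = (if m = 0 then 1 else (0::'a))"
  "mps_coeff (F + G) m = mps_coeff F m + (mps_coeff G m :: 'a)"
  "mps_coeff (- F) m = - (mps_coeff F m :: 'a)"
  "mps_coeff (F - G) m = mps_coeff F m - (mps_coeff G m :: 'a)"
  by (simp_all add: zero_mps_def one_mps_def plus_mps_def uminus_mps_def minus_mps_def)

lemma mps_coeff_mult:
  "mps_coeff (F * G) m = (\<Sum>(a, b) | a + b = m. mps_coeff F a * (mps_coeff G b :: 'a))"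
  by (simp add: times_mps_def)

instance
proof
  fix F G H :: "'a mps"
  have fin: "finite {p. fst p + snd p = m}" for m :: "nat \<Rightarrow>\<^sub>0 nat"
    using finite_monomial_splits[of m] by (simp add: case_prod_unfold)
  show "F * G = G * F"
  proof (rule mps_eqI)
    fix m
    show "mps_coeff (F * G) m = mps_coeff (G * F) m"
      unfolding mps_coeff_mult
      by (rule sum.reindex_bij_witness[of _ prod.swap prod.swap])
        (auto simp: algebra_simps)
  qed
  show "F * G * H = F * (G * H)"
  proof (rule mps_eqI)
    fix m
    have "mps_coeff (F * G * H) m
      = (\<Sum>(c, d)\<in>{(c, d). c + d = m}. \<Sum>(a, b)\<in>{(a, b). a + b = c}.
          mps_coeff F a * mps_coeff G b * mps_coeff H d)"
      unfolding mps_coeff_mult by (simp add: sum_distrib_right case_prod_unfold)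
    also have "\<dots> = (\<Sum>(x, y)\<in>Sigma {(c, d). c + d = m} (\<lambda>x. {(a, b). a + b = fst x}).
          mps_coeff F (fst y) * mps_coeff G (snd y) * mps_coeff H (snd x))"
      by (subst sum.Sigma[symmetric])
        (auto simp: fin case_prod_unfold)
    also have "\<dots> = (\<Sum>(x, y)\<in>Sigma {(c, d). c + d = m} (\<lambda>x. {(a, b). a + b = snd x}).
          mps_coeff F (fst x) * (mps_coeff G (fst y) * mps_coeff H (snd y)))"
      by (rule sum.reindex_bij_witness
            [of _ "\<lambda>((a, e), (b, d)). ((a + b, d), (a, b))" "\<lambda>((c, d), (a, b)). ((a, b + d), (b, d))"])
         (auto simp: algebra_simps)
    also have "\<dots> = (\<Sum>(a, e)\<in>{(a, e). a + e = m}. \<Sum>(b, d)\<in>{(b, d). b + d = e}.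
          mps_coeff F a * (mps_coeff G b * mps_coeff H d))"
      by (subst sum.Sigma[symmetric])
        (auto simp: fin case_prod_unfold)
    also have "\<dots> = mps_coeff (F * (G * H)) m"
      unfolding mps_coeff_mult by (simp add: sum_distrib_left case_prod_unfold)
    finally show "mps_coeff (F * G * H) m = mps_coeff (F * (G * H)) m" .
  qed
  show "1 * F = F"
  proof (rule mps_eqI)
    fix m
    have "mps_coeff (1 * F) m = (\<Sum>x\<in>{(0, m)}. mps_coeff 1 (fst x) * mps_coeff F (snd x))"
      unfolding mps_coeff_mult case_prod_unfold
      by (rule sum.mono_neutral_right) (auto simp: finite_monomial_splits[unfolded case_prod_unfold])
    thus "mps_coeff (1 * F) m = mps_coeff F m" by simp
  qed
  show "(F + G) * H = F * H + G * H"
    by (rule mps_eqI) (simp add: mps_coeff_mult distrib_right sum.distrib case_prod_unfold)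
  show "(0 :: 'a mps) \<noteq> 1"
    by (metis mps_coeff_simps(1,2) zero_neq_one)
qed (rule mps_eqI; simp add: algebra_simps; fail)+

end

definition mps_map :: "('a \<Rightarrow> 'b) \<Rightarrow> 'a mps \<Rightarrow> 'b mps" where
  "mps_map f F = Abs_mps (\<lambda>m. f (mps_coeff F m))"

definition monomial_power :: "nat \<Rightarrow> (nat \<Rightarrow>\<^sub>0 nat) \<Rightarrow> (nat \<Rightarrow>\<^sub>0 nat)" where
  "monomial_power d m = Poly_Mapping.map (\<lambda>e. d * e) m"

text \<open>\<open>mps_subst d F\<close> is \<open>F(t\<^sup>d)\<close> (every variable \<open>t\<^sub>j\<close> replaced by its \<open>d\<close>-th power);
  for \<open>d > 0\<close> the sum has at most one term.\<close>

definition mps_subst :: "nat \<Rightarrow> 'a::comm_monoid_add mps \<Rightarrow> 'a mps" where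
  "mps_subst d F = Abs_mps (\<lambda>m. \<Sum>n | monomial_power d n = m. mps_coeff F n)"

lemma mps_coeff_map [simp]: "mps_coeff (mps_map f F) m = f (mps_coeff F m)"
  by (simp add: mps_map_def)

lemma lookup_monomial_power [simp]: "Poly_Mapping.lookup (monomial_power d m) i = d * Poly_Mapping.lookup m i"
  by (simp add: monomial_power_def map.rep_eq when_def)

lemma monomial_power_inject [simp]: "d > 0 \<Longrightarrow> monomial_power d m = monomial_power d n \<longleftrightarrow> m = n"
  by (auto simp: poly_mapping_eq_iff fun_eq_iff)

lemma monomial_power_add: "monomial_power d (m + n) = monomial_power d m + monomial_power d n"
  by (rule poly_mapping_eqI) (simp add: lookup_add algebra_simps)

lemma monomial_power_0 [simp]: "monomial_power d 0 = 0"
  by (rule poly_mapping_eqI) simp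

lemma monomial_power_1 [simp]: "monomial_power (Suc 0) m = m"
  by (rule poly_mapping_eqI) simp

lemma monomial_power_mult: "monomial_power i (monomial_power j m) = monomial_power (i * j) m"
  by (rule poly_mapping_eqI) simp

lemma monomial_power_decomp:
  assumes "d > 0" "a + b = monomial_power d n"
  shows "a \<in> range (monomial_power d) \<longleftrightarrow> b \<in> range (monomial_power d)"
proof -
  have *: "c \<in> range (monomial_power d) \<longleftrightarrow> (\<forall>i. d dvd Poly_Mapping.lookup c i)" for c
  proof
    assume "\<forall>i. d dvd Poly_Mapping.lookup c i"
    hence "c = monomial_power d (Poly_Mapping.map (\<lambda>e. e div d) c)"
      by (intro poly_mapping_eqI) (auto simp: map.rep_eq when_def)
    thus "c \<in> range (monomial_power d)" by blast
  qed auto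
  have "Poly_Mapping.lookup a i + Poly_Mapping.lookup b i = d * Poly_Mapping.lookup n i" for i
    using assms(2) by (metis lookup_add lookup_monomial_power)
  hence "d dvd Poly_Mapping.lookup a i \<longleftrightarrow> d dvd Poly_Mapping.lookup b i" for i
    by (metis dvd_add_left_iff dvd_add_right_iff dvd_triv_left)
  thus ?thesis unfolding * by blast
qed

lemma mps_coeff_subst_power [simp]:
  "d > 0 \<Longrightarrow> mps_coeff (mps_subst d F) (monomial_power d n) = mps_coeff F n"
  by (simp add: mps_subst_def)

lemma mps_coeff_subst_other:
  "m \<notin> range (monomial_power d) \<Longrightarrow> mps_coeff (mps_subst d F) m = 0"
  unfolding mps_subst_def by (auto intro!: sum.neutral)

lemma mps_subst_eqI:
  assumes "d > 0" "\<And>n. mps_coeff G (monomial_power d n) = mps_coeff F n"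
    "\<And>m. m \<notin> range (monomial_power d) \<Longrightarrow> mps_coeff G m = 0"
  shows "mps_subst d F = G"
proof (rule mps_eqI)
  fix m show "mps_coeff (mps_subst d F) m = mps_coeff G m"
    by (cases "m \<in> range (monomial_power d)") (auto simp: assms mps_coeff_subst_other)
qed

lemma mps_subst_mult:
  fixes F G :: "'a::comm_ring_1 mps"
  assumes d: "d > 0"
  shows "mps_subst d (F * G) = mps_subst d F * mps_subst d G"
proof (rule mps_subst_eqI[OF d])
  fix n
  have "mps_coeff (mps_subst d F * mps_subst d G) (monomial_power d n)
    = (\<Sum>x\<in>map_prod (monomial_power d) (monomial_power d) ` {(a, b). a + b = n}.
        mps_coeff (mps_subst d F) (fst x) * mps_coeff (mps_subst d G) (snd x))"
    unfolding mps_coeff_mult case_prod_unfold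
  proof (rule sum.mono_neutral_right)
    show "finite {p. fst p + snd p = monomial_power d n}"
      using finite_monomial_splits[unfolded case_prod_unfold] .
    show "map_prod (monomial_power d) (monomial_power d) ` {p. fst p + snd p = n}
        \<subseteq> {p. fst p + snd p = monomial_power d n}"
      by (auto simp: monomial_power_add)
    show "\<forall>x\<in>{p. fst p + snd p = monomial_power d n}
        - map_prod (monomial_power d) (monomial_power d) ` {p. fst p + snd p = n}.
        mps_coeff (mps_subst d F) (fst x) * mps_coeff (mps_subst d G) (snd x) = 0"
    proof (rule ballI, rule ccontr)
      fix x
      assume x: "x \<in> {p. fst p + snd p = monomial_power d n}
        - map_prod (monomial_power d) (monomial_power d) ` {p. fst p + snd p = n}"
        and "mps_coeff (mps_subst d F) (fst x) * mps_coeff (mps_subst d G) (snd x) \<noteq> 0"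
      hence "fst x \<in> range (monomial_power d)" "snd x \<in> range (monomial_power d)"
        by (metis mps_coeff_subst_other mult_zero_left mult_zero_right)+
      then obtain a b where ab: "x = (monomial_power d a, monomial_power d b)"
        by (metis imageE prod.collapse)
      with x d have "a + b = n" by (simp flip: monomial_power_add)
      with x ab show False by force
    qed
  qed
  also have "\<dots> = mps_coeff (F * G) n"
    unfolding mps_coeff_mult using d
    by (subst sum.reindex) (auto simp: inj_on_def case_prod_unfold)
  finally show "mps_coeff (mps_subst d F * mps_subst d G) (monomial_power d n) = mps_coeff (F * G) n" .
next
  fix m assume m: "m \<notin> range (monomial_power d)"
  have "mps_coeff (mps_subst d F) a * mps_coeff (mps_subst d G) b = 0" if "a + b = m" for a b
  proof (rule ccontr)
    assume "mps_coeff (mps_subst d F) a * mps_coeff (mps_subst d G) b \<noteq> 0"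
    hence "a \<in> range (monomial_power d)" "b \<in> range (monomial_power d)"
      by (metis mps_coeff_subst_other mult_zero_left mult_zero_right)+
    with that m show False by (auto simp flip: monomial_power_add)
  qed
  thus "mps_coeff (mps_subst d F * mps_subst d G) m = 0"
    unfolding mps_coeff_mult by (intro sum.neutral) auto
qed

instantiation mps :: (adams_ring) adams_ring
begin

definition adams_mps :: "nat \<Rightarrow> 'a mps \<Rightarrow> 'a mps" where
  "adams_mps i F = mps_subst i (mps_map (adams i) F)"

instance
proof
  fix F G :: "'a mps" and i j n :: nat
  {
    assume n: "n > 0"
    let ?c = "Abs_mps (\<lambda>m. if m = 0 then recip n else 0) :: 'a mps"
    have cf: "mps_coeff (of_nat k * F) m = of_nat k * (mps_coeff F m :: 'a)" for k F m
      by (induction k) (simp_all add: algebra_simps)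
    have "of_nat n * ?c = 1"
      by (rule mps_eqI) (simp add: cf of_nat_mult_recip[OF n])
    thus "(of_nat n :: 'a mps) dvd 1" by (metis dvd_triv_left)
  }
  have adams0: "adams i (0::'a) = 0" if "i > 0" for i
    using adams_add[OF that, of 0 0] by simp
  have adams_sum: "adams i (\<Sum>x\<in>A. f x) = (\<Sum>x\<in>A. adams i (f x :: 'a))" if "i > 0"
    for i and f :: "_ \<Rightarrow> 'a" and A :: "((nat \<Rightarrow>\<^sub>0 nat) \<times> (nat \<Rightarrow>\<^sub>0 nat)) set"
    using that by (induction A rule: infinite_finite_induct) (simp_all add: adams0 adams_add)
  show "adams 1 F = F"
    by (unfold adams_mps_def, rule mps_subst_eqI) (auto simp: adams_id[unfolded One_nat_def])
  assume i: "i > 0"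
  show "adams i (F + G) = adams i F + adams i G"
    unfolding adams_mps_def
    by (rule mps_subst_eqI[OF i]) (simp_all add: i adams_add mps_coeff_subst_other)
  show "adams i (1 :: 'a mps) = 1"
    unfolding adams_mps_def
  proof (rule mps_subst_eqI[OF i])
    fix n :: "nat \<Rightarrow>\<^sub>0 nat"
    show "mps_coeff 1 (monomial_power i n) = mps_coeff (mps_map (adams i) (1 :: 'a mps)) n"
      using monomial_power_inject[OF i, of n 0] by (simp add: i adams_one adams0)
  next
    fix m assume "m \<notin> range (monomial_power i)"
    thus "mps_coeff (1 :: 'a mps) m = 0" by (metis (full_types) mps_coeff_simps(2) monomial_power_0 rangeI)
  qed
  have "mps_map (adams i) (F * G) = mps_map (adams i) F * mps_map (adams i) G"
    by (rule mps_eqI) (simp add: mps_coeff_mult adams_sum i adams_mult case_prod_unfold)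
  thus "adams i (F * G) = adams i F * adams i G"
    unfolding adams_mps_def by (simp add: mps_subst_mult[OF i])
  assume j: "j > 0"
  have "mps_subst (i * j) (mps_map (adams (i * j)) F) = adams i (adams j F)"
  proof (rule mps_subst_eqI)
    fix n
    show "mps_coeff (adams i (adams j F)) (monomial_power (i * j) n) = mps_coeff (mps_map (adams (i * j)) F) n"
      using i j by (simp add: adams_mps_def adams_adams flip: monomial_power_mult)
  next
    fix m assume m: "m \<notin> range (monomial_power (i * j))"
    show "mps_coeff (adams i (adams j F)) m = 0"
    proof (cases "m \<in> range (monomial_power i)")
      case True
      then obtain m' where m': "m = monomial_power i m'" by blast
      with m have "m' \<notin> range (monomial_power j)" by (auto simp: monomial_power_mult)
      with m' i show ?thesis by (simp add: adams_mps_def mps_coeff_subst_other adams0)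
    qed (simp add: adams_mps_def mps_coeff_subst_other)
  qed (use i j in simp)
  thus "adams i (adams j F) = adams (i * j) F" unfolding adams_mps_def ..
qed

end

text \<open>
  Infinite sums and products of power series are formal: a net converges iff each coefficient
  is eventually constant.
\<close>

instantiation mps :: (type) t2_space
begin

definition open_mps :: "'a mps set \<Rightarrow> bool" where
  "open_mps U \<longleftrightarrow> (\<forall>F\<in>U. \<exists>S. finite S \<and> {G. \<forall>m\<in>S. mps_coeff G m = mps_coeff F m} \<subseteq> U)"

instance
proof
  show "open (UNIV :: 'a mps set)" by (auto simp: open_mps_def)
next
  fix U W :: "'a mps set" assume U: "open U" and W: "open W"
  show "open (U \<inter> W)"
    unfolding open_mps_def
  proof
    fix F assume "F \<in> U \<inter> W"
    with U W obtain S T where "finite S" "{G. \<forall>m\<in>S. mps_coeff G m = mps_coeff F m} \<subseteq> U"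
      "finite T" "{G. \<forall>m\<in>T. mps_coeff G m = mps_coeff F m} \<subseteq> W"
      unfolding open_mps_def by (meson IntD1 IntD2)
    thus "\<exists>S. finite S \<and> {G. \<forall>m\<in>S. mps_coeff G m = mps_coeff F m} \<subseteq> U \<inter> W"
      by (intro exI[of _ "S \<union> T"]) auto
  qed
next
  fix K :: "'a mps set set" assume "\<forall>U\<in>K. open U"
  thus "open (\<Union>K)" unfolding open_mps_def by (meson UnionE UnionI subset_iff)
next
  fix F G :: "'a mps" assume "F \<noteq> G"
  then obtain m where m: "mps_coeff F m \<noteq> mps_coeff G m" by (metis mps_eqI)
  have "open {E. mps_coeff E m = c}" for c :: 'a
    unfolding open_mps_def by (auto intro!: exI[of _ "{m}"])
  with m show "\<exists>U W. open U \<and> open W \<and> F \<in> U \<and> G \<in> W \<and> U \<inter> W = {}"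
    by (intro exI[of _ "{E. mps_coeff E m = mps_coeff F m}"]
        exI[of _ "{E. mps_coeff E m = mps_coeff G m}"]) auto
qed

end

lemma tendsto_mps_iff:
  "(f \<longlongrightarrow> F) net \<longleftrightarrow> (\<forall>m. eventually (\<lambda>x. mps_coeff (f x) m = mps_coeff F m) net)"
proof
  assume f: "(f \<longlongrightarrow> F) net"
  show "\<forall>m. eventually (\<lambda>x. mps_coeff (f x) m = mps_coeff F m) net"
  proof
    fix m
    have "open {E. mps_coeff E m = mps_coeff F m}"
      unfolding open_mps_def by (auto intro!: exI[of _ "{m}"])
    from topological_tendstoD[OF f this] show "eventually (\<lambda>x. mps_coeff (f x) m = mps_coeff F m) net"
      by simp
  qed
next
  assume f: "\<forall>m. eventually (\<lambda>x. mps_coeff (f x) m = mps_coeff F m) net"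
  show "(f \<longlongrightarrow> F) net"
  proof (rule topological_tendstoI)
    fix U assume "open U" "F \<in> U"
    then obtain S where S: "finite S" "{G. \<forall>m\<in>S. mps_coeff G m = mps_coeff F m} \<subseteq> U"
      unfolding open_mps_def by blast
    have "eventually (\<lambda>x. \<forall>m\<in>S. mps_coeff (f x) m = mps_coeff F m) net"
      using f S(1) by (simp add: eventually_ball_finite)
    thus "eventually (\<lambda>x. f x \<in> U) net"
      by (rule eventually_mono) (use S(2) in auto)
  qed
qed

text \<open>\<open>has_mps_prod f A P\<close>: the (unordered) infinite product of \<open>f\<close> over \<open>A\<close> converges to \<open>P\<close>.\<close>

definition has_mps_prod :: "('i \<Rightarrow> 'a::comm_ring_1 mps) \<Rightarrow> 'i set \<Rightarrow> 'a mps \<Rightarrow> bool" where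
  "has_mps_prod f A P \<longleftrightarrow> (prod f \<longlongrightarrow> P) (finite_subsets_at_top A)"

definition Fil1 :: "'a::zero mps set" where
  "Fil1 = {F. mps_coeff F 0 = 0}"

definition mps_over :: "'a set \<Rightarrow> 'a mps set" where
  "mps_over R = {F. \<forall>m. mps_coeff F m \<in> R}"

definition mps_exp :: "'a::adams_ring mps \<Rightarrow> 'a mps" where
  "mps_exp F = (\<Sum>\<^sub>\<infinity>n. recip (fact n) * F ^ n)"

definition Exp_sigma :: "'a::adams_ring mps \<Rightarrow> 'a mps" where
  "Exp_sigma F = mps_exp (\<Sum>\<^sub>\<infinity>j\<in>{1..}. recip j * adams j F)"

text \<open>
  \<open>Exp_sigma\<close> maps \<open>Fil1\<close> bijectively onto \<open>1 + Fil1\<close>, also over every subring closed under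
  division by positive integers and under Adams operations. Hence the inverse below
  sends \<open>1 + Fil1\<close> over such a subring to series over the same subring.
\<close>

definition Log_sigma :: "'a::adams_ring mps \<Rightarrow> 'a mps" where
  "Log_sigma = inv_into Fil1 Exp_sigma"


section \<open>Admissible integer sets and motivic Euler products\<close>

definition zfixed :: "'v set \<Rightarrow> (int \<Rightarrow> 'v \<Rightarrow> 'v) \<Rightarrow> nat \<Rightarrow> 'v set" where
  "zfixed V \<phi> k = {v \<in> V. \<forall>j. \<phi> (int k * j) v = v}"

locale admissible_zset = group_action integer_group V \<phi>
  for V :: "'v set" and \<phi> :: "int \<Rightarrow> 'v \<Rightarrow> 'v" +
  assumes exhausted: "V = (\<Union>k\<in>{1..}. zfixed V \<phi> k)"
    and finite_fixed: "k \<ge> 1 \<Longrightarrow> finite (zfixed V \<phi> k)"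

text \<open>The action on \<open>V\<^bsub>k\<^esub>\<close>; the underlying set is unchanged.\<close>

definition zscale :: "nat \<Rightarrow> (int \<Rightarrow> 'v \<Rightarrow> 'v) \<Rightarrow> int \<Rightarrow> 'v \<Rightarrow> 'v" where
  "zscale k \<phi> = (\<lambda>j. \<phi> (int k * j))"

abbreviation zorbits :: "'v set \<Rightarrow> (int \<Rightarrow> 'v \<Rightarrow> 'v) \<Rightarrow> 'v set set" where
  "zorbits V \<phi> \<equiv> orbits integer_group V \<phi>"

abbreviation zdeg :: "(int \<Rightarrow> 'v \<Rightarrow> 'v) \<Rightarrow> 'v \<Rightarrow> nat" where
  "zdeg \<phi> v \<equiv> card (orbit integer_group \<phi> v)"

text \<open>
  The ring \<open>C(V, W(\<complex>))\<close> as a subset of the ring of all functions on the ambient type. Values off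
  \<open>V\<close> are unconstrained: ring and Adams operations are pointwise, and such values are never
  evaluated.
\<close>

definition orbit_funs :: "'v set \<Rightarrow> (int \<Rightarrow> 'v \<Rightarrow> 'v) \<Rightarrow> ('v \<Rightarrow> witt) set" where
  "orbit_funs V \<phi> = {f. \<forall>v\<in>V. \<forall>j. f (\<phi> j v) = f v}"

definition at_orbit :: "('v \<Rightarrow> 'a) \<Rightarrow> 'v set \<Rightarrow> 'a" where
  "at_orbit f \<omega> = the_elem (f ` \<omega>)"

definition zrestrict :: "nat \<Rightarrow> (int \<Rightarrow> 'v \<Rightarrow> 'v) \<Rightarrow> ('v \<Rightarrow> witt) \<Rightarrow> 'v \<Rightarrow> witt" where
  "zrestrict k \<phi> f = (\<lambda>x. adams (k div gcd (zdeg \<phi> x) k) (f x))"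

definition zintegral :: "'v set \<Rightarrow> (int \<Rightarrow> 'v \<Rightarrow> 'v) \<Rightarrow> ('v \<Rightarrow> witt) \<Rightarrow> witt" where
  "zintegral V \<phi> f = (\<Sum>\<^sub>\<infinity>\<omega>\<in>zorbits V \<phi>. witt_subst (card \<omega>) (at_orbit f \<omega>))"

definition euler_product :: "'v set \<Rightarrow> (int \<Rightarrow> 'v \<Rightarrow> 'v) \<Rightarrow> ('v \<Rightarrow> witt) mps \<Rightarrow> witt mps" where
  "euler_product V \<phi> H = Exp_sigma (mps_map (zintegral V \<phi>) (Log_sigma H))"

abbreviation mps_at_orbit :: "('v \<Rightarrow> 'a) mps \<Rightarrow> 'v set \<Rightarrow> 'a mps" where
  "mps_at_orbit H \<omega> \<equiv> mps_map (\<lambda>f. at_orbit f \<omega>) H"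

definition mps_ghost :: "witt mps \<Rightarrow> nat \<Rightarrow> complex mps" where
  "mps_ghost G i = mps_map (\<lambda>w. ghost w i) G"

end

theory Submission
  imports Defs "HOL-Computational_Algebra.Formal_Laurent_Series"
begin

text \<open>
  Both product formulas come from taking logarithms. Let \<open>L\<close> be the plethystic logarithm of \<open>H\<close>, so
  that the Euler product is \<open>exp (\<Sum>j. p\<^sub>j(\<integral>L) / j)\<close>. The \<open>k\<close>-th ghost component is a ring
  homomorphism compatible with limits, so it commutes with \<open>exp\<close>, and it turns \<open>p\<^sub>j F\<close> into
  \<open>F\<^bsub>jk\<^esub>(t\<^sup>j)\<close>. The ghost components of the integral are finite sums: an orbit of size \<open>d\<close>
  contributes \<open>d L(\<omega>)\<^bsub>n/d\<^esub>\<close> to the \<open>n\<close>-th one if \<open>d\<close> divides \<open>n\<close>, and nothing otherwise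
  (\<open>ghost_zintegral\<close>). Hence the logarithm of the left-hand side is the sum over all orbits
  \<open>\<omega>\<close> of the sum over \<open>j\<close> with \<open>d dvd j * k\<close> of \<open>(d/j) L(\<omega>)\<^bsub>jk/d\<^esub>(t\<^sup>j)\<close>.

  With \<open>g = gcd k d\<close> these \<open>j\<close> are the multiples \<open>i * (d/g)\<close>, and the inner sum becomes
  \<open>g\<close> times the sum over \<open>i\<close> of \<open>(1/i) L(\<omega>)\<^bsub>ik/g\<^esub>(t\<^bsup>id/g\<^esup>)\<close> (\<open>mps_coeff_orbit_log\<close>). By the
  same commutation rules, now applied to the plethystic exponential of \<open>L(\<omega>)\<close>, this is the logarithm
  of the \<open>g\<close>-th power of \<open>H(\<omega>)\<^bsub>k/g\<^esub>(t\<^bsup>d/g\<^esup>)\<close>. Summing over orbits is justified by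
  \<open>ghost_adams_sum_zintegral\<close>, and exponentiating gives the product over the orbits of \<open>V\<close>.

  For the product over the orbits of the action multiplied by \<open>k\<close>, an orbit of size \<open>d\<close> breaks up into
  \<open>g\<close> orbits of size \<open>d/g\<close> (\<open>orbit_parts\<close>), each of which carries the factor
  \<open>H(\<omega>)\<^bsub>k/g\<^esub>(t\<^bsup>d/g\<^esup>)\<close> (\<open>mps_ghost_zrestrict_at_part\<close>); so the \<open>g\<close>-th power is a product of
  \<open>g\<close> equal factors of the finer product.

  All infinite sums and products are handled modulo series of order at least \<open>N\<close>, where only orbits
  of size at most \<open>N * k\<close> matter; admissibility makes these finite in number. The same
  approximation shows that the plethystic exponential is bijective, which is needed for \<open>L\<close> to
  exist and to be constant on orbits.
\<close>

section \<open>The filtration by order of vanishing\<close>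

definition total_degree :: "(nat \<Rightarrow>\<^sub>0 nat) \<Rightarrow> nat" where
  "total_degree m = (\<Sum>i\<in>Poly_Mapping.keys m. Poly_Mapping.lookup m i)"

lemma total_degree_superset:
  assumes "finite A" "Poly_Mapping.keys m \<subseteq> A"
  shows "total_degree m = (\<Sum>i\<in>A. Poly_Mapping.lookup m i)"
  unfolding total_degree_def using assms
  by (intro sum.mono_neutral_left) (auto simp: in_keys_iff)

lemma total_degree_add: "total_degree (a + b) = total_degree a + total_degree b"
proof -
  let ?A = "Poly_Mapping.keys a \<union> Poly_Mapping.keys b"
  have "Poly_Mapping.keys (a + b) \<subseteq> ?A" by (auto simp: in_keys_iff lookup_add)
  hence "total_degree (a + b) = (\<Sum>i\<in>?A. Poly_Mapping.lookup (a + b) i)"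
    by (intro total_degree_superset) auto
  thus ?thesis
    by (simp add: lookup_add sum.distrib total_degree_superset[of ?A a] total_degree_superset[of ?A b])
qed

lemma total_degree_eq_0_iff [simp]: "total_degree m = 0 \<longleftrightarrow> m = 0"
  unfolding total_degree_def
  by (auto simp: in_keys_iff intro!: poly_mapping_eqI)

lemma total_degree_monomial_power [simp]:
  "total_degree (monomial_power d m) = d * total_degree m"
proof -
  have "Poly_Mapping.keys (monomial_power d m) \<subseteq> Poly_Mapping.keys m"
    by (auto simp: in_keys_iff)
  hence "total_degree (monomial_power d m)
      = (\<Sum>i\<in>Poly_Mapping.keys m. Poly_Mapping.lookup (monomial_power d m) i)"
    by (intro total_degree_superset) auto
  thus ?thesis by (simp add: total_degree_def sum_distrib_left)
qed

text \<open>
  All convergence is controlled by this filtration. It defines a finer topology than coefficientwise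
  convergence, since there are infinitely many monomials of each positive degree; but in every limit
  that occurs the partial sums or products do stabilise modulo each \<open>mps_fil N\<close>.
\<close>

definition mps_fil :: "nat \<Rightarrow> 'a::zero mps set" where
  "mps_fil N = {F. \<forall>m. total_degree m < N \<longrightarrow> mps_coeff F m = 0}"

lemma Fil1_eq: "Fil1 = mps_fil 1"
  by (auto simp: Fil1_def mps_fil_def)

lemma fil_mono: "F \<in> mps_fil N \<Longrightarrow> M \<le> N \<Longrightarrow> F \<in> mps_fil M"
  by (auto simp: mps_fil_def)

lemma fil_0 [simp]: "0 \<in> mps_fil N"
  by (auto simp: mps_fil_def)

lemma fil_add: "F \<in> mps_fil N \<Longrightarrow> G \<in> mps_fil N \<Longrightarrow> F + G \<in> mps_fil N"
  by (auto simp: mps_fil_def)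

lemma fil_uminus: "F \<in> mps_fil N \<Longrightarrow> - F \<in> mps_fil N"
  by (auto simp: mps_fil_def)

lemma fil_diff: "F \<in> mps_fil N \<Longrightarrow> G \<in> mps_fil N \<Longrightarrow> F - G \<in> mps_fil N"
  by (auto simp: mps_fil_def)

lemma fil_sum: "(\<And>x. x \<in> A \<Longrightarrow> f x \<in> mps_fil N) \<Longrightarrow> sum f A \<in> mps_fil N"
  by (induction A rule: infinite_finite_induct) (auto intro: fil_add)

lemma fil_mult:
  assumes "F \<in> mps_fil M" "G \<in> mps_fil N"
  shows "F * G \<in> mps_fil (M + N)"
proof -
  have "mps_coeff F a * mps_coeff G b = 0" if "total_degree (a + b) < M + N" for a b
  proof -
    have "total_degree a < M \<or> total_degree b < N"
      using that by (auto simp: total_degree_add)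
    thus ?thesis using assms by (auto simp: mps_fil_def)
  qed
  thus ?thesis by (auto simp: mps_fil_def mps_coeff_mult intro!: sum.neutral)
qed

lemma fil_mult_left: "G \<in> mps_fil N \<Longrightarrow> F * G \<in> mps_fil N"
  using fil_mult[of F 0 G N] by (simp add: mps_fil_def)

lemma fil_mult_right: "F \<in> mps_fil N \<Longrightarrow> F * G \<in> mps_fil N"
  using fil_mult_left[of F N G] by (simp add: mult.commute)

lemma fil_power: "F \<in> mps_fil N \<Longrightarrow> F ^ n \<in> mps_fil (n * N)"
  by (induction n) (simp add: mps_fil_def, simp add: fil_mult)

lemma fil_subst:
  assumes "F \<in> mps_fil N" shows "mps_subst d F \<in> mps_fil (d * N)"
  unfolding mps_fil_def
proof safe
  fix m assume m: "total_degree m < d * N"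
  show "mps_coeff (mps_subst d F) m = 0"
  proof (cases "m \<in> range (monomial_power d)")
    case True
    then obtain n where "m = monomial_power d n" by blast
    with m assms show ?thesis by (auto simp: mps_fil_def)
  qed (rule mps_coeff_subst_other)
qed

lemma fil_map: "h 0 = 0 \<Longrightarrow> F \<in> mps_fil N \<Longrightarrow> mps_map h F \<in> mps_fil N"
  by (auto simp: mps_fil_def)

lemma fil_diff_trans: "F - G \<in> mps_fil N \<Longrightarrow> G - H \<in> mps_fil N \<Longrightarrow> F - H \<in> mps_fil N"
  using fil_add[of "F - G" N "G - H"] by simp

lemma fil_diff_sym: "F - G \<in> mps_fil N \<Longrightarrow> G - F \<in> mps_fil N"
  using fil_uminus[of "F - G" N] by simp

lemma fil_diff_mult:
  assumes "F - F' \<in> mps_fil N" "G - G' \<in> mps_fil N"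
  shows "F * G - F' * G' \<in> mps_fil N"
proof -
  have "F * G - F' * G' = (F - F') * G + F' * (G - G')" by (simp add: algebra_simps)
  thus ?thesis using assms by (auto intro: fil_add fil_mult_left fil_mult_right)
qed

lemma fil_prod_1:
  "(\<And>x. x \<in> A \<Longrightarrow> f x - 1 \<in> mps_fil N) \<Longrightarrow> prod f A - 1 \<in> mps_fil N"
proof (induction A rule: infinite_finite_induct)
  case (insert x A)
  have "f x * prod f A - 1 * 1 \<in> mps_fil N"
    by (rule fil_diff_mult) (use insert in auto)
  thus ?case using insert by simp
qed auto

lemma eq_of_fil_diff: "(\<And>N. F - G \<in> mps_fil N) \<Longrightarrow> F = G"
proof (rule mps_eqI)
  fix m assume "\<And>N. F - G \<in> mps_fil N"
  from this[of "Suc (total_degree m)"] show "mps_coeff F m = mps_coeff G m"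
    by (simp add: mps_fil_def)
qed

lemma mps_coeff_sum: "mps_coeff (sum f A) m = (\<Sum>x\<in>A. mps_coeff (f x) m)"
  by (induction A rule: infinite_finite_induct) auto

lemma mps_coeff_of_nat_mult: "mps_coeff (of_nat n * F) m = of_nat n * mps_coeff F m"
  by (induction n) (simp_all add: algebra_simps)

text \<open>
  Infinite sums are replaced by finite ones through this lemma: a sum whose \<open>n\<close>-th term has order at least
  \<open>n\<close> agrees with a finite partial sum up to the order of the omitted terms. Convergence comes for
  free, since each coefficient of the sum is a finite sum.
\<close>

lemma infsum_fil_diff:
  fixes f :: "nat \<Rightarrow> 'a::comm_ring_1 mps"
  assumes f: "\<And>n. n \<in> A \<Longrightarrow> f n \<in> mps_fil n"
    and B: "finite B" "B \<subseteq> A" "\<And>n. n \<in> A - B \<Longrightarrow> f n \<in> mps_fil M"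
  shows "infsum f A - sum f B \<in> mps_fil M"
proof -
  define S where "S = Abs_mps (\<lambda>m. \<Sum>n\<in>A \<inter> {..total_degree m}. mps_coeff (f n) m)"
  have "(sum f \<longlongrightarrow> S) (finite_subsets_at_top A)"
    unfolding tendsto_mps_iff
  proof
    fix m
    have "\<forall>\<^sub>F X in finite_subsets_at_top A. finite X \<and> A \<inter> {..total_degree m} \<subseteq> X \<and> X \<subseteq> A"
      by (intro eventually_finite_subsets_at_top_weakI eventually_conj
          eventually_finite_subsets_at_top[THEN iffD2] exI[of _ "A \<inter> {..total_degree m}"]) auto
    thus "\<forall>\<^sub>F X in finite_subsets_at_top A. mps_coeff (sum f X) m = mps_coeff S m"
    proof (rule eventually_mono)
      fix X assume X: "finite X \<and> A \<inter> {..total_degree m} \<subseteq> X \<and> X \<subseteq> A"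
      show "mps_coeff (sum f X) m = mps_coeff S m"
        unfolding mps_coeff_sum S_def mps_coeff_Abs
        by (rule sum.mono_neutral_right) (use X f in \<open>force simp: mps_fil_def\<close>)+
    qed
  qed
  hence S: "infsum f A = S"
    using has_sum_def infsumI by blast
  have "mps_coeff S m = mps_coeff (sum f B) m" if m: "total_degree m < M" for m
  proof -
    let ?C = "A \<inter> {..total_degree m} \<union> B"
    have "mps_coeff S m = (\<Sum>n\<in>?C. mps_coeff (f n) m)"
      unfolding S_def mps_coeff_Abs
      by (rule sum.mono_neutral_left) (use f B in \<open>force simp: mps_fil_def\<close>)+
    also have "\<dots> = (\<Sum>n\<in>B. mps_coeff (f n) m)"
      by (rule sum.mono_neutral_right) (use B m in \<open>force simp: mps_fil_def\<close>)+
    finally show ?thesis by (simp add: mps_coeff_sum)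
  qed
  thus ?thesis unfolding S by (simp add: mps_fil_def)
qed

lemma infsum_fil_truncate:
  fixes f :: "nat \<Rightarrow> 'a::comm_ring_1 mps"
  assumes "\<And>n. n \<in> A \<Longrightarrow> f n \<in> mps_fil n"
  shows "infsum f A - sum f (A \<inter> {..<N}) \<in> mps_fil N"
proof (rule infsum_fil_diff)
  fix n assume "n \<in> A - A \<inter> {..<N}"
  thus "f n \<in> mps_fil N" using assms fil_mono[of "f n" n N] by auto
qed (use assms in auto)

lemma infsum_fil:
  fixes f :: "nat \<Rightarrow> 'a::comm_ring_1 mps"
  assumes "\<And>n. n \<in> A \<Longrightarrow> f n \<in> mps_fil n" "\<And>n. n \<in> A \<Longrightarrow> f n \<in> mps_fil M"
  shows "infsum f A \<in> mps_fil M"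
  using infsum_fil_diff[of A f "{}" M] assms by simp

text \<open>
  The form in which convergence of the two Euler products is established: modulo each \<open>mps_fil N\<close>
  the product is reached by a finite set of factors, and all remaining factors are \<open>1\<close>.
\<close>

lemma has_mps_prod_fil:
  assumes "\<And>N. \<exists>S. finite S \<and> S \<subseteq> A \<and> prod f S - P \<in> mps_fil N \<and> (\<forall>x\<in>A - S. f x - 1 \<in> mps_fil N)"
  shows "has_mps_prod f A P"
  unfolding has_mps_prod_def tendsto_mps_iff
proof
  fix m
  obtain S where S: "finite S" "S \<subseteq> A" "prod f S - P \<in> mps_fil (Suc (total_degree m))"
    "\<And>x. x \<in> A - S \<Longrightarrow> f x - 1 \<in> mps_fil (Suc (total_degree m))"
    using assms by meson
  have "\<forall>\<^sub>F X in finite_subsets_at_top A. finite X \<and> S \<subseteq> X \<and> X \<subseteq> A"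
    using S by (intro eventually_finite_subsets_at_top[THEN iffD2] exI[of _ S]) auto
  thus "\<forall>\<^sub>F X in finite_subsets_at_top A. mps_coeff (prod f X) m = mps_coeff P m"
  proof (rule eventually_mono)
    fix X assume X: "finite X \<and> S \<subseteq> X \<and> X \<subseteq> A"
    have "prod f (X - S) - 1 \<in> mps_fil (Suc (total_degree m))"
      by (rule fil_prod_1) (use S X in auto)
    hence "prod f (X - S) * prod f S - 1 * P \<in> mps_fil (Suc (total_degree m))"
      using S by (intro fil_diff_mult)
    moreover have "prod f (X - S) * prod f S = prod f X"
      using X by (metis prod.subset_diff)
    ultimately show "mps_coeff (prod f X) m = mps_coeff P m"
      by (simp add: mps_fil_def)
  qed
qed

section \<open>Filtered ring homomorphisms and the exponential\<close>

lemma recip_unique: "n > 0 \<Longrightarrow> of_nat n * y = 1 \<Longrightarrow> y = (recip n :: 'a::adams_ring)"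
  by (metis mult.assoc mult.commute mult_1 of_nat_mult_recip)

lemma recip_1 [simp]: "recip (Suc 0) = 1"
  by (rule recip_unique[symmetric]) auto

lemma recip_mult: "m > 0 \<Longrightarrow> n > 0 \<Longrightarrow> recip (m * n) = (recip m * recip n :: 'a::adams_ring)"
proof (rule recip_unique[symmetric])
  assume "m > 0" "n > 0"
  have "of_nat (m * n) * (recip m * recip n) = (of_nat m * recip m) * (of_nat n * recip n :: 'a)"
    by (simp add: algebra_simps)
  thus "of_nat (m * n) * (recip m * recip n) = (1 :: 'a)"
    using \<open>m > 0\<close> \<open>n > 0\<close> by (simp add: of_nat_mult_recip)
qed auto

lemma recip_mult_cancel:
  "m > 0 \<Longrightarrow> n > 0 \<Longrightarrow> recip (m * n) * of_nat n = (recip m :: 'a::adams_ring)"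
  using of_nat_mult_recip[of n, where 'a = 'a]
  by (simp add: recip_mult mult.assoc) (simp add: mult.commute)

lemma mps_coeff_recip_mult: "n > 0 \<Longrightarrow> mps_coeff (recip n * F) m = recip n * mps_coeff F m"
proof -
  assume n: "n > 0"
  have "of_nat n * (recip n * F) = F"
    using of_nat_mult_recip[OF n] by (metis mult.assoc mult_1)
  hence "of_nat n * mps_coeff (recip n * F) m = mps_coeff F m"
    by (metis mps_coeff_of_nat_mult)
  hence "recip n * (of_nat n * mps_coeff (recip n * F) m) = recip n * mps_coeff F m" by simp
  thus ?thesis using of_nat_mult_recip[OF n] by (metis mult.assoc mult.commute mult_1)
qed

text \<open>
  Taking a ghost component, evaluating coefficients at a point of the integer set and substituting
  \<open>t\<^sub>j\<^sup>d\<close> for \<open>t\<^sub>j\<close> are all ring homomorphisms that respect the filtration. Such maps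
  commute with convergent sums, hence with the exponential.
\<close>

locale filtered_hom =
  fixes \<Phi> :: "'a::adams_ring mps \<Rightarrow> 'b::adams_ring mps"
  assumes hom_add: "\<Phi> (F + G) = \<Phi> F + \<Phi> G"
    and hom_mult: "\<Phi> (F * G) = \<Phi> F * \<Phi> G"
    and hom_one: "\<Phi> 1 = 1"
    and hom_fil: "F \<in> mps_fil N \<Longrightarrow> \<Phi> F \<in> mps_fil N"
begin

lemma hom_zero: "\<Phi> 0 = 0"
  using hom_add[of 0 0] by simp

lemma hom_diff: "\<Phi> (F - G) = \<Phi> F - \<Phi> G"
  using hom_add[of "F - G" G] by simp

lemma hom_of_nat: "\<Phi> (of_nat n) = of_nat n"
  by (induction n) (simp_all add: hom_zero hom_add hom_one)

lemma hom_recip: "n > 0 \<Longrightarrow> \<Phi> (recip n) = recip n"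
  by (rule recip_unique) (simp_all add: of_nat_mult_recip hom_one flip: hom_of_nat hom_mult)

lemma hom_power: "\<Phi> (F ^ n) = \<Phi> F ^ n"
  by (induction n) (simp_all add: hom_one hom_mult)

lemma hom_sum: "\<Phi> (sum f A) = (\<Sum>x\<in>A. \<Phi> (f x))"
  by (induction A rule: infinite_finite_induct) (simp_all add: hom_zero hom_add)

lemma hom_infsum:
  assumes "\<And>n. n \<in> A \<Longrightarrow> f n \<in> mps_fil n"
  shows "\<Phi> (infsum f A) = (\<Sum>\<^sub>\<infinity>n\<in>A. \<Phi> (f n))"
proof (rule eq_of_fil_diff)
  fix N
  have "\<Phi> (infsum f A) - (\<Sum>n\<in>A \<inter> {..<N}. \<Phi> (f n)) \<in> mps_fil N"
    using hom_fil[OF infsum_fil_truncate[of A f N]] assms by (simp add: hom_diff hom_sum)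
  moreover have "(\<Sum>\<^sub>\<infinity>n\<in>A. \<Phi> (f n)) - (\<Sum>n\<in>A \<inter> {..<N}. \<Phi> (f n)) \<in> mps_fil N"
    by (rule infsum_fil_truncate) (use assms hom_fil in auto)
  ultimately show "\<Phi> (infsum f A) - (\<Sum>\<^sub>\<infinity>n\<in>A. \<Phi> (f n)) \<in> mps_fil N"
    using fil_diff_trans fil_diff_sym by blast
qed

end

lemma fil_exp_term: "F \<in> mps_fil 1 \<Longrightarrow> recip (fact n) * F ^ n \<in> mps_fil n"
  using fil_power[of F 1 n] by (auto intro: fil_mult_left)

lemma (in filtered_hom) hom_exp:
  assumes "F \<in> mps_fil 1" shows "\<Phi> (mps_exp F) = mps_exp (\<Phi> F)"
  unfolding mps_exp_def
  by (subst hom_infsum) (use assms in \<open>simp_all add: fil_exp_term hom_mult hom_recip hom_power\<close>)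

lemma mps_exp_0 [simp]: "mps_exp 0 = (1 :: 'a::adams_ring mps)"
proof -
  have *: "mps_exp (0 :: 'a mps) - 1 \<in> mps_fil N" for N
    using infsum_fil_diff[of UNIV "\<lambda>n. recip (fact n) * (0 :: 'a mps) ^ n" "{0}" N]
      fil_exp_term[of "0 :: 'a mps"]
    by (simp add: mps_exp_def zero_power)
  show ?thesis by (rule eq_of_fil_diff) (rule *)
qed

lemma mps_exp_approx:
  assumes "D \<in> mps_fil N" "N \<ge> 1"
  shows "mps_exp D - 1 - D \<in> mps_fil (Suc N)"
proof -
  have D: "D \<in> mps_fil 1" using assms fil_mono by blast
  have "mps_exp D - sum (\<lambda>n. recip (fact n) * D ^ n) {0, 1} \<in> mps_fil (Suc N)"
    unfolding mps_exp_def
  proof (rule infsum_fil_diff)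
    fix n :: nat assume "n \<in> UNIV - {0, 1}"
    hence n: "n \<ge> 2" by auto
    have "Suc N \<le> 2 * N" using assms by simp
    also have "\<dots> \<le> n * N" using n by simp
    finally have "D ^ n \<in> mps_fil (Suc N)"
      using fil_power[OF assms(1)] fil_mono by blast
    thus "recip (fact n) * D ^ n \<in> mps_fil (Suc N)" by (rule fil_mult_left)
  qed (use D fil_exp_term in auto)
  thus ?thesis by (simp add: algebra_simps)
qed

lemma binomial_recip:
  assumes "i \<le> n"
  shows "recip (fact n) * of_nat (n choose i) = (recip (fact i) * recip (fact (n - i)) :: 'a::adams_ring)"
proof -
  have "fact n = fact i * fact (n - i) * (n choose i)"
    using binomial_fact_lemma[OF assms] by simp
  thus ?thesis using assms by (simp add: recip_mult_cancel flip: recip_mult)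
qed

text \<open>
  Modulo order \<open>N\<close> both sides are truncated to degree below \<open>N\<close>. The product of the truncations runs
  over a square of index pairs, the truncation of the left side (by the binomial formula) over the
  triangle \<open>i + j < N\<close> inside it, and the terms outside the triangle have order at least \<open>N\<close>.
\<close>

lemma mps_exp_add:
  assumes F: "F \<in> mps_fil 1" and G: "G \<in> mps_fil 1"
  shows "mps_exp (F + G) = mps_exp F * mps_exp G"
proof (rule eq_of_fil_diff)
  fix N
  define e where "e = (\<lambda>(X :: 'a mps) n. recip (fact n) * X ^ n)"
  have e: "e X n \<in> mps_fil n" if "X \<in> mps_fil 1" for X n
    using fil_exp_term[OF that] by (simp add: e_def)
  have trunc: "mps_exp X - (\<Sum>n<N. e X n) \<in> mps_fil N" if "X \<in> mps_fil 1" for X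
    using infsum_fil_truncate[of UNIV "e X" N] e[OF that] by (simp add: mps_exp_def e_def)
  let ?T = "{(i, j). i + j < N}"
  have binom: "(\<Sum>i\<le>n. e F i * e G (n - i)) = e (F + G) n" for n
    unfolding e_def binomial_ring sum_distrib_left
  proof (rule sum.cong[OF refl])
    fix i assume "i \<in> {..n}"
    hence "recip (fact n) * of_nat (n choose i) = (recip (fact i) * recip (fact (n - i)) :: 'a mps)"
      by (intro binomial_recip) simp
    hence "(recip (fact n) * of_nat (n choose i)) * (F ^ i * G ^ (n - i))
        = (recip (fact i) * recip (fact (n - i))) * (F ^ i * G ^ (n - i))" by simp
    thus "recip (fact i) * F ^ i * (recip (fact (n - i)) * G ^ (n - i))
        = recip (fact n) * (of_nat (n choose i) * F ^ i * G ^ (n - i))"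
      by (simp add: mult_ac)
  qed
  have T: "(\<Sum>(i, j)\<in>?T. e F i * e G j) = (\<Sum>n<N. e (F + G) n)"
    by (subst sum.triangle_reindex) (simp add: binom)
  have "(\<Sum>i<N. e F i) * (\<Sum>j<N. e G j) = (\<Sum>(i, j)\<in>{..<N} \<times> {..<N}. e F i * e G j)"
    by (simp add: sum_product sum.cartesian_product)
  also have "\<dots> = (\<Sum>(i, j)\<in>{..<N} \<times> {..<N} - ?T. e F i * e G j) + (\<Sum>(i, j)\<in>?T. e F i * e G j)"
    by (rule sum.subset_diff) auto
  finally have "(\<Sum>i<N. e F i) * (\<Sum>j<N. e G j) - (\<Sum>n<N. e (F + G) n)
      = (\<Sum>(i, j)\<in>{..<N} \<times> {..<N} - ?T. e F i * e G j)"
    by (simp add: T)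
  also have "\<dots> \<in> mps_fil N"
  proof (rule fil_sum)
    fix p assume "p \<in> {..<N} \<times> {..<N} - ?T"
    moreover obtain i j where "p = (i, j)" by (cases p)
    ultimately show "(case p of (i, j) \<Rightarrow> e F i * e G j) \<in> mps_fil N"
      using fil_mono[OF fil_mult[OF e[OF F, of i] e[OF G, of j]], of N] by auto
  qed
  finally have "(\<Sum>n<N. e (F + G) n) - (\<Sum>i<N. e F i) * (\<Sum>j<N. e G j) \<in> mps_fil N"
    by (rule fil_diff_sym)
  moreover have "(\<Sum>i<N. e F i) * (\<Sum>j<N. e G j) - mps_exp F * mps_exp G \<in> mps_fil N"
    by (intro fil_diff_mult fil_diff_sym[OF trunc] F G)
  ultimately show "mps_exp (F + G) - mps_exp F * mps_exp G \<in> mps_fil N"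
    using fil_diff_trans trunc[OF fil_add[OF F G]] by blast
qed

lemma mps_exp_sum:
  "(\<And>x. x \<in> A \<Longrightarrow> f x \<in> mps_fil 1) \<Longrightarrow> mps_exp (sum f A) = (\<Prod>x\<in>A. mps_exp (f x))"
proof (induction A rule: infinite_finite_induct)
  case (insert x A)
  have "f x \<in> mps_fil 1" "sum f A \<in> mps_fil 1"
    using insert.prems by (auto intro: fil_sum)
  thus ?case using insert by (simp add: mps_exp_add)
qed simp_all

lemma mps_exp_of_nat_mult:
  "F \<in> mps_fil 1 \<Longrightarrow> mps_exp (of_nat n * F) = mps_exp F ^ n"
  using mps_exp_sum[of "{..<n}" "\<lambda>_. F"] by simp

lemma mps_exp_cong_fil:
  assumes "F \<in> mps_fil 1" "G \<in> mps_fil 1" "F - G \<in> mps_fil N"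
  shows "mps_exp F - mps_exp G \<in> mps_fil N"
proof (cases "N = 0")
  case False
  have "mps_exp F = mps_exp G * mps_exp (F - G)"
    using assms fil_diff by (subst mps_exp_add[symmetric]) auto
  hence "mps_exp F - mps_exp G = mps_exp G * (mps_exp (F - G) - 1 - (F - G)) + mps_exp G * (F - G)"
    by (simp add: algebra_simps)
  moreover have "mps_exp (F - G) - 1 - (F - G) \<in> mps_fil N"
    using mps_exp_approx[OF assms(3)] False fil_mono le_SucI by fastforce
  ultimately show ?thesis using assms(3) by (auto intro: fil_add fil_mult_left)
qed (auto simp: mps_fil_def)

section \<open>The plethystic exponential is bijective\<close>

text \<open>
  The exponent in the plethystic exponential. Separating it from \<open>mps_exp\<close> matters because the ghost
  components commute with \<open>mps_exp\<close> but not with the Adams operations.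
\<close>

definition adams_sum :: "'a::adams_ring mps \<Rightarrow> 'a mps" where
  "adams_sum F = (\<Sum>\<^sub>\<infinity>j\<in>{1..}. recip j * adams j F)"

lemma Exp_sigma_eq: "Exp_sigma F = mps_exp (adams_sum F)"
  by (simp add: Exp_sigma_def adams_sum_def)

lemma adams_zero: "j > 0 \<Longrightarrow> adams j (0 :: 'a::adams_ring) = 0"
  using adams_add[of j "0::'a" 0] by simp

lemma fil_adams:
  assumes "j > 0" "F \<in> mps_fil N" shows "adams j F \<in> mps_fil (j * N)"
  unfolding adams_mps_def using assms by (intro fil_subst fil_map) (auto simp: adams_zero)

lemma fil_adams_term:
  "F \<in> mps_fil 1 \<Longrightarrow> j \<in> {1..} \<Longrightarrow> recip j * adams j F \<in> mps_fil j"
  using fil_adams[of j F 1] by (auto intro: fil_mult_left)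

lemma fil_adams_sum:
  assumes "F \<in> mps_fil N" "N \<ge> 1" shows "adams_sum F \<in> mps_fil N"
  unfolding adams_sum_def
proof (rule infsum_fil)
  fix j :: nat assume j: "j \<in> {1..}"
  show "recip j * adams j F \<in> mps_fil j"
    using fil_mono[OF assms] j by (intro fil_adams_term) auto
  have "N \<le> j * N" using j by simp
  hence "adams j F \<in> mps_fil N"
    using fil_mono[OF fil_adams[OF _ assms(1), of j]] j by simp
  thus "recip j * adams j F \<in> mps_fil N" by (rule fil_mult_left)
qed

lemma adams_sum_approx:
  assumes "D \<in> mps_fil N" "N \<ge> 1"
  shows "adams_sum D - D \<in> mps_fil (Suc N)"
proof -
  have D: "D \<in> mps_fil 1" using assms fil_mono by blast
  have "adams_sum D - (\<Sum>j\<in>{1}. recip j * adams j D) \<in> mps_fil (Suc N)"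
    unfolding adams_sum_def
  proof (rule infsum_fil_diff)
    fix j :: nat assume "j \<in> {1..} - {1}"
    hence j: "j \<ge> 2" by auto
    have "Suc N \<le> 2 * N" using assms by simp
    also have "\<dots> \<le> j * N" using j by simp
    finally have "adams j D \<in> mps_fil (Suc N)"
      using fil_mono[OF fil_adams[OF _ assms(1), of j]] j by simp
    thus "recip j * adams j D \<in> mps_fil (Suc N)" by (rule fil_mult_left)
  qed (use D fil_adams_term in auto)
  thus ?thesis by (simp add: adams_id[unfolded One_nat_def])
qed

lemma adams_sum_add:
  assumes F: "F \<in> mps_fil 1" and G: "G \<in> mps_fil 1"
  shows "adams_sum (F + G) = adams_sum F + adams_sum G"
proof (rule eq_of_fil_diff)
  fix N
  define s where "s X = (\<Sum>j\<in>{1..} \<inter> {..<N}. recip j * adams j X)" for X :: "'a mps"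
  have trunc: "adams_sum X - s X \<in> mps_fil N" if "X \<in> mps_fil 1" for X
    unfolding adams_sum_def s_def using that by (intro infsum_fil_truncate fil_adams_term)
  have "s (F + G) = s F + s G"
    unfolding s_def sum.distrib[symmetric]
    by (rule sum.cong) (auto simp: adams_add algebra_simps)
  hence "adams_sum (F + G) - (adams_sum F + adams_sum G)
      = (adams_sum (F + G) - s (F + G)) - ((adams_sum F - s F) + (adams_sum G - s G))"
    by (simp add: algebra_simps)
  also have "\<dots> \<in> mps_fil N"
    by (intro fil_diff fil_add trunc F G)
  finally show "adams_sum (F + G) - (adams_sum F + adams_sum G) \<in> mps_fil N" .
qed

lemma Exp_sigma_0 [simp]: "Exp_sigma (0 :: 'a::adams_ring mps) = 1"
proof -
  have "adams_sum (0 :: 'a mps) = 0"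
    using adams_sum_add[of "0 :: 'a mps" 0] by simp
  thus ?thesis by (simp add: Exp_sigma_eq)
qed

lemma Exp_sigma_add:
  assumes "F \<in> mps_fil 1" "G \<in> mps_fil 1"
  shows "Exp_sigma (F + G) = Exp_sigma F * Exp_sigma G"
  using assms by (simp add: Exp_sigma_eq adams_sum_add mps_exp_add fil_adams_sum)

text \<open>
  To leading order the plethystic exponential is \<open>D \<mapsto> 1 + D\<close>, because both higher powers and
  Adams operations with \<open>j \<ge> 2\<close> at least double the order. Together with \<open>Exp_sigma_add\<close> this yields
  injectivity (a kernel element has arbitrarily high order) and surjectivity (each error of an approximate logarithm is its own first-order correction).
\<close>

lemma Exp_sigma_approx:
  assumes "D \<in> mps_fil N" "N \<ge> 1"
  shows "Exp_sigma D - 1 - D \<in> mps_fil (Suc N)"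
proof -
  have "(mps_exp (adams_sum D) - 1 - adams_sum D) + (adams_sum D - D) \<in> mps_fil (Suc N)"
    by (intro fil_add mps_exp_approx fil_adams_sum adams_sum_approx assms)
  moreover have "(mps_exp (adams_sum D) - 1 - adams_sum D) + (adams_sum D - D) = Exp_sigma D - 1 - D"
    by (simp add: Exp_sigma_eq)
  ultimately show ?thesis by (simp only:)
qed

lemma Exp_sigma_uminus:
  "F \<in> mps_fil 1 \<Longrightarrow> Exp_sigma F * Exp_sigma (- F) = 1"
  using Exp_sigma_add[of F "- F"] fil_uminus[of F 1] by simp

lemma Exp_sigma_eq_1:
  assumes "D \<in> mps_fil 1" "Exp_sigma D = 1" shows "D = 0"
proof (rule eq_of_fil_diff)
  fix N
  have "D \<in> mps_fil (Suc N)"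
  proof (induction N)
    case (Suc N)
    from Exp_sigma_approx[OF Suc] show ?case
      using assms(2) fil_uminus[of "- D"] by simp
  qed (use assms in simp)
  thus "D - 0 \<in> mps_fil N" using fil_mono[of D "Suc N" N] by simp
qed

lemma Exp_sigma_inject:
  assumes "F \<in> mps_fil 1" "G \<in> mps_fil 1" "Exp_sigma F = Exp_sigma G"
  shows "F = G"
proof -
  have "Exp_sigma (F + - G) = 1"
    using assms Exp_sigma_uminus[of G] by (simp add: Exp_sigma_add fil_uminus del: add_uminus_conv_diff)
  hence "F + - G = 0" using assms by (intro Exp_sigma_eq_1) (auto intro: fil_diff)
  thus ?thesis by simp
qed

lemma Exp_sigma_surj:
  fixes H :: "'a::adams_ring mps"
  assumes H: "H - 1 \<in> mps_fil 1"
  shows "\<exists>F\<in>mps_fil 1. Exp_sigma F = H"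
proof -
  \<comment> \<open>Successive approximation: \<open>A\<close> is a logarithm of \<open>H\<close> up to the relative error \<open>err A\<close>, and
    adding that error to \<open>A\<close> raises the order of the error.\<close>
  define err where "err A = H * Exp_sigma (- A) - 1" for A
  define A where "A = rec_nat 0 (\<lambda>_ A. A + err A)"
  have A_0: "A 0 = 0" and A_Suc: "A (Suc n) = A n + err (A n)" for n
    by (simp_all add: A_def)
  have A: "A n \<in> mps_fil 1 \<and> err (A n) \<in> mps_fil (Suc n)" for n
  proof (induction n)
    case 0
    thus ?case using H by (simp add: A_0 err_def)
  next
    case (Suc n)
    let ?E = "err (A n)"
    have E: "?E \<in> mps_fil 1" by (rule fil_mono[OF conjunct2[OF Suc]]) simp
    \<comment> \<open>With \<open>H * Exp (- A) = 1 + E\<close> the new error is \<open>(1 + E) * Exp (- E) - 1\<close>, and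
      \<open>Exp (- E)\<close> is \<open>1 - E\<close> up to higher order, so what remains is \<open>- E\<^sup>2\<close>.\<close>
    have "Exp_sigma (- A n + - ?E) = Exp_sigma (- A n) * Exp_sigma (- ?E)"
      using Suc E by (intro Exp_sigma_add fil_uminus) auto
    moreover have "H * Exp_sigma (- A n) = 1 + ?E" by (simp add: err_def)
    ultimately have "H * Exp_sigma (- A n + - ?E) = (1 + ?E) * Exp_sigma (- ?E)"
      by (simp only: mult.assoc[symmetric])
    hence "err (A (Suc n)) = (1 + ?E) * (Exp_sigma (- ?E) - 1 - - ?E) - ?E * ?E"
      by (simp add: A_Suc err_def[of "A n + err (A n)"] algebra_simps)
    moreover have "Exp_sigma (- ?E) - 1 - - ?E \<in> mps_fil (Suc (Suc n))"
      using Suc by (intro Exp_sigma_approx fil_uminus) auto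
    moreover have "?E * ?E \<in> mps_fil (Suc (Suc n))"
      using fil_mono[OF fil_mult[OF conjunct2[OF Suc] conjunct2[OF Suc]]] by simp
    ultimately have "err (A (Suc n)) \<in> mps_fil (Suc (Suc n))"
      by (metis fil_diff fil_mult_left)
    thus ?case using Suc E by (simp add: A_Suc fil_add)
  qed
  define F where "F = (\<Sum>\<^sub>\<infinity>n. err (A n))"
  have err_fil: "err (A n) \<in> mps_fil n" "err (A n) \<in> mps_fil 1" for n
    using fil_mono[OF conjunct2[OF A[of n]]] by auto
  have F: "F \<in> mps_fil 1"
    unfolding F_def by (intro infsum_fil err_fil)
  have "H * Exp_sigma (- F) = 1"
  proof (rule eq_of_fil_diff)
    fix N
    have "F - (\<Sum>n\<in>UNIV \<inter> {..<N}. err (A n)) \<in> mps_fil N"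
      unfolding F_def by (intro infsum_fil_truncate err_fil)
    moreover have "A N = (\<Sum>n<N. err (A n))"
      by (induction N) (simp_all add: A_0 A_Suc)
    ultimately have "A N - F \<in> mps_fil N"
      by (simp add: fil_diff_sym)
    hence "adams_sum (A N - F) \<in> mps_fil N"
      by (cases "N = 0") (simp add: mps_fil_def, simp add: fil_adams_sum)
    moreover have "adams_sum (A N - F) \<in> mps_fil 1"
      using conjunct1[OF A] F by (intro fil_adams_sum fil_diff) simp_all
    ultimately have "mps_exp (adams_sum (A N - F)) - mps_exp 0 \<in> mps_fil N"
      by (intro mps_exp_cong_fil) simp_all
    hence "Exp_sigma (A N - F) - 1 \<in> mps_fil N"
      by (simp add: Exp_sigma_eq)
    moreover have "H * Exp_sigma (- A N) - 1 \<in> mps_fil N"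
      using fil_mono[OF conjunct2[OF A[of N]], of N] by (simp add: err_def)
    ultimately have "H * Exp_sigma (- A N) * Exp_sigma (A N - F) - 1 * 1 \<in> mps_fil N"
      by (intro fil_diff_mult)
    moreover have "Exp_sigma (- A N) * Exp_sigma (A N - F) = Exp_sigma (- F)"
      using A F by (subst Exp_sigma_add[symmetric]) (auto intro: fil_diff fil_uminus)
    ultimately show "H * Exp_sigma (- F) - 1 \<in> mps_fil N"
      by (simp add: mult.assoc)
  qed
  hence "Exp_sigma F = H"
    using Exp_sigma_uminus[OF F] by (metis mult.assoc mult.commute mult_1)
  with F show ?thesis by blast
qed

lemma Log_sigma:
  assumes "H - 1 \<in> mps_fil 1"
  shows "Log_sigma H \<in> mps_fil 1" "Exp_sigma (Log_sigma H) = H"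
proof -
  have "H \<in> Exp_sigma ` Fil1"
    using Exp_sigma_surj[OF assms] by (auto simp: Fil1_eq)
  thus "Log_sigma H \<in> mps_fil 1" "Exp_sigma (Log_sigma H) = H"
    unfolding Log_sigma_def by (metis Fil1_eq inv_into_into, metis f_inv_into_f)
qed

lemma (in filtered_hom) hom_Exp_sigma:
  assumes adams: "\<And>j F. j > 0 \<Longrightarrow> \<Phi> (adams j F) = adams j (\<Phi> F)" and F: "F \<in> mps_fil 1"
  shows "\<Phi> (Exp_sigma F) = Exp_sigma (\<Phi> F)"
proof -
  have "\<Phi> (adams_sum F) = adams_sum (\<Phi> F)"
    unfolding adams_sum_def using F
    by (subst hom_infsum) (auto simp: hom_mult hom_recip adams intro!: infsum_cong fil_adams_term)
  thus ?thesis using F by (simp add: Exp_sigma_eq hom_exp fil_adams_sum)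
qed

section \<open>Ghost components of power series\<close>

text \<open>
  Trivial Adams operations on the coefficients turn complex power series into a target for filtered
  homomorphisms, so that the same exponential serves before and after taking ghost components.
\<close>

instantiation complex :: adams_ring
begin

definition adams_complex :: "nat \<Rightarrow> complex \<Rightarrow> complex" where
  "adams_complex i x = x"

instance
  by standard (simp_all add: adams_complex_def dvd_field_iff)

end

lemma recip_complex: "n > 0 \<Longrightarrow> recip n = (1 / of_nat n :: complex)"
  by (rule recip_unique[symmetric]) auto

lemma filtered_hom_map:
  fixes h :: "'a::adams_ring \<Rightarrow> 'b::adams_ring"
  assumes "\<And>x y. h (x + y) = h x + h y" "\<And>x y. h (x * y) = h x * h y" "h 1 = 1"
  shows "filtered_hom (mps_map h)"
proof
  have h0: "h 0 = 0" using assms(1)[of 0 0] by simp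
  have hsum: "h (\<Sum>x\<in>A. f x) = (\<Sum>x\<in>A. h (f x))"
    for f and A :: "((nat \<Rightarrow>\<^sub>0 nat) \<times> (nat \<Rightarrow>\<^sub>0 nat)) set"
    by (induction A rule: infinite_finite_induct) (simp_all add: h0 assms)
  show "mps_map h (F * G) = mps_map h F * mps_map h G" for F G
    by (rule mps_eqI) (simp add: mps_coeff_mult hsum assms case_prod_unfold)
  show "mps_map h (F + G) = mps_map h F + mps_map h G" for F G
    by (rule mps_eqI) (simp add: assms)
  show "mps_map h 1 = 1"
    by (rule mps_eqI) (simp add: assms h0)
qed (use assms(1)[of 0 0] fil_map in auto)

lemma filtered_hom_ghost: "k > 0 \<Longrightarrow> filtered_hom (\<lambda>G. mps_ghost G k)"
  unfolding mps_ghost_def by (rule filtered_hom_map) simp_all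

lemma filtered_hom_eval:
  "filtered_hom (mps_map (\<lambda>f. f v) :: ('v \<Rightarrow> witt) mps \<Rightarrow> witt mps)"
  by (rule filtered_hom_map) (simp_all add: plus_fun_def times_fun_def one_fun_def)

lemma eval_Exp_sigma:
  fixes F :: "('v \<Rightarrow> witt) mps"
  assumes "F \<in> mps_fil 1"
  shows "mps_map (\<lambda>f. f v) (Exp_sigma F) = Exp_sigma (mps_map (\<lambda>f. f v) F)"
proof -
  interpret filtered_hom "mps_map (\<lambda>f. f v) :: ('v \<Rightarrow> witt) mps \<Rightarrow> witt mps"
    by (rule filtered_hom_eval)
  show ?thesis
  proof (rule hom_Exp_sigma[OF _ assms])
    fix j :: nat and F :: "('v \<Rightarrow> witt) mps" assume j: "j > 0"
    show "mps_map (\<lambda>f. f v) (adams j F) = adams j (mps_map (\<lambda>f. f v) F)"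
    proof (rule mps_eqI)
      fix m
      show "mps_coeff (mps_map (\<lambda>f. f v) (adams j F)) m = mps_coeff (adams j (mps_map (\<lambda>f. f v) F)) m"
      proof (cases "m \<in> range (monomial_power j)")
        case True
        then obtain n where "m = monomial_power j n" by blast
        thus ?thesis using j by (simp add: adams_mps_def adams_fun_def)
      next
        case False
        thus ?thesis by (simp add: adams_mps_def mps_coeff_subst_other zero_fun_def)
      qed
    qed
  qed
qed

lemma filtered_hom_subst:
  assumes d: "d > 0" shows "filtered_hom (mps_subst d)"
proof
  show "mps_subst d (F + G) = mps_subst d F + mps_subst d G" for F G
    by (rule mps_subst_eqI) (simp_all add: d mps_coeff_subst_other)
  show "mps_subst d 1 = 1"
  proof (rule mps_subst_eqI)
    fix n show "mps_coeff 1 (monomial_power d n) = mps_coeff 1 n"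
      using monomial_power_inject[OF d, of n 0] by simp
  next
    fix m assume "m \<notin> range (monomial_power d)"
    hence "m \<noteq> 0" by (metis monomial_power_0 rangeI)
    thus "mps_coeff 1 m = 0" by simp
  qed (rule d)
  show "mps_subst d F \<in> mps_fil N" if "F \<in> mps_fil N" for F N
  proof (rule fil_mono[OF fil_subst[OF that]])
    show "N \<le> d * N" using d by simp
  qed
qed (rule mps_subst_mult[OF d])

lemma mps_coeff_subst_mult:
  assumes "e > 0" "i > 0"
  shows "mps_coeff (mps_subst (e * i) F) (monomial_power e n) = mps_coeff (mps_subst i F) n"
proof (cases "n \<in> range (monomial_power i)")
  case True
  then obtain l where "n = monomial_power i l" by blast
  thus ?thesis using assms by (simp add: monomial_power_mult)
next
  case False
  hence "monomial_power e n \<notin> range (monomial_power (e * i))"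
    using assms by (auto simp flip: monomial_power_mult)
  thus ?thesis using False by (simp add: mps_coeff_subst_other)
qed

lemma fil_ghost: "G \<in> mps_fil N \<Longrightarrow> mps_ghost G k \<in> mps_fil N"
  unfolding mps_ghost_def by (rule fil_map) simp_all

text \<open>
  Adams operations shift ghost components, which is why an Adams operation on series over the Witt
  vectors becomes a substitution of powers combined with a multiplication of the ghost index.
\<close>

lemma mps_ghost_adams:
  assumes "j > 0" "k > 0"
  shows "mps_ghost (adams j G) k = mps_subst j (mps_ghost G (j * k))"
proof (rule mps_subst_eqI[symmetric])
  show "mps_coeff (mps_ghost (adams j G) k) (monomial_power j n) = mps_coeff (mps_ghost G (j * k)) n" for n
    using assms by (simp add: mps_ghost_def adams_mps_def)
  show "mps_coeff (mps_ghost (adams j G) k) m = 0" if "m \<notin> range (monomial_power j)" for m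
    using that assms by (simp add: mps_ghost_def adams_mps_def mps_coeff_subst_other)
qed (rule assms)

lemma mps_coeff_ghost_adams_sum:
  assumes G: "G \<in> mps_fil 1" and k: "k > 0" and T: "total_degree m \<le> T"
  shows "mps_coeff (mps_ghost (adams_sum G) k) m
    = (\<Sum>j\<in>{1..T}. mps_coeff (mps_subst j (mps_ghost G (j * k))) m / of_nat j)"
proof -
  interpret filtered_hom "\<lambda>G. mps_ghost G k" by (rule filtered_hom_ghost[OF k])
  let ?f = "\<lambda>j. recip j * mps_subst j (mps_ghost G (j * k))"
  have "mps_ghost (adams_sum G) k = infsum ?f {1..}"
    unfolding adams_sum_def using G k
    by (subst hom_infsum)
      (auto simp: hom_mult hom_recip mps_ghost_adams intro!: infsum_cong fil_adams_term)
  moreover have "infsum ?f {1..} - sum ?f {1..T} \<in> mps_fil (Suc T)"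
  proof (rule infsum_fil_diff)
    fix j :: nat
    have j: "?f j \<in> mps_fil j"
      using fil_subst[OF fil_ghost[OF G], of j "j * k"] by (auto intro: fil_mult_left)
    show "?f j \<in> mps_fil j" by (rule j)
    assume "j \<in> {1..} - {1..T}"
    thus "?f j \<in> mps_fil (Suc T)" by (intro fil_mono[OF j]) auto
  qed auto
  ultimately have "mps_coeff (mps_ghost (adams_sum G) k) m = mps_coeff (sum ?f {1..T}) m"
    using T by (simp add: mps_fil_def)
  thus ?thesis
    by (simp add: mps_coeff_sum mps_coeff_recip_mult recip_complex)
qed

text \<open>
  The arithmetic behind both descriptions of the product: multiplication by \<open>k\<close> shrinks an orbit of
  size \<open>d\<close> to size \<open>d div gcd k d\<close>.
\<close>

lemma dvd_mult_iff_div_gcd: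
  fixes d k :: nat
  assumes "d > 0"
  shows "int d dvd int k * x \<longleftrightarrow> int (d div gcd k d) dvd x"
proof -
  define g where "g = gcd k d"
  have g: "g > 0" using assms by (simp add: g_def)
  have d: "int d = int g * int (d div g)" and k: "int k = int g * int (k div g)"
    by (simp_all add: g_def flip: of_nat_mult)
  have cop: "coprime (int (d div g)) (int (k div g))"
    using div_gcd_coprime[of k d] assms by (simp add: g_def coprime_commute)
  have "int d dvd int k * x \<longleftrightarrow> int g * int (d div g) dvd int g * (int (k div g) * x)"
    by (subst d, subst k) (simp add: mult.assoc)
  also have "\<dots> \<longleftrightarrow> int (d div g) dvd int (k div g) * x"
    using g by simp
  also have "\<dots> \<longleftrightarrow> int (d div g) dvd x"
    using cop by (rule coprime_dvd_mult_right_iff)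
  finally show ?thesis by (simp add: g_def)
qed

text \<open>
  The contribution of one orbit of size \<open>d\<close>. With \<open>g = gcd k d\<close>, the indices \<open>j\<close> for which \<open>d\<close>
  divides \<open>j * k\<close> are exactly \<open>j = (d div g) * i\<close>; then \<open>j * k div d = i * (k div g)\<close> and
  \<open>d / j = g / i\<close>, so the sum on the right is the sum over \<open>i\<close> that defines the left-hand side. The
  right-hand side is what the integral produces, the left-hand side is the logarithm of one factor of
  the Euler product.
\<close>

lemma mps_coeff_orbit_log:
  assumes X: "X \<in> mps_fil 1" and d: "d > 0" and k: "k > 0" and T: "total_degree m \<le> T"
  shows "mps_coeff (of_nat (gcd k d) *
      mps_subst (d div gcd k d) (mps_ghost (adams_sum X) (k div gcd k d))) m
    = (\<Sum>j | j \<in> {1..T} \<and> d dvd j * k.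
        of_nat d / of_nat j * mps_coeff (mps_subst j (mps_ghost X (j * k div d))) m)"
proof -
  define g e c where "g = gcd k d" and "e = d div g" and "c = k div g"
  have g: "g > 0" using d by (simp add: g_def)
  have dge: "d = e * g" and kgc: "k = c * g" by (simp_all add: g_def e_def c_def)
  have e: "e > 0" and c: "c > 0" using d k dge kgc by (auto intro: gr0I)
  have dvd: "d dvd j * k \<longleftrightarrow> e dvd j" for j
    using dvd_mult_iff_div_gcd[OF d, of k "int j"]
    by (simp add: e_def g_def mult.commute flip: of_nat_mult)
  let ?t = "\<lambda>j. of_nat d / of_nat j * mps_coeff (mps_subst j (mps_ghost X (j * k div d))) m"
  have "mps_coeff (of_nat g * mps_subst e (mps_ghost (adams_sum X) c)) m
      = (\<Sum>j | j \<in> {1..T} \<and> e dvd j. ?t j)"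
  proof (cases "m \<in> range (monomial_power e)")
    case False
    have "?t j = 0" if "e dvd j" for j
    proof -
      obtain i where "j = e * i" using \<open>e dvd j\<close> by (elim dvdE)
      hence "m \<notin> range (monomial_power j)"
        using False by (auto simp flip: monomial_power_mult)
      thus ?thesis by (simp add: mps_coeff_subst_other)
    qed
    hence "(\<Sum>j | j \<in> {1..T} \<and> e dvd j. ?t j) = 0" by (intro sum.neutral) auto
    thus ?thesis using False by (simp add: mps_coeff_of_nat_mult mps_coeff_subst_other)
  next
    case True
    then obtain n where n: "m = monomial_power e n" by blast
    let ?s = "\<lambda>i. of_nat g * (mps_coeff (mps_subst i (mps_ghost X (i * c))) n / of_nat i)"
    have "total_degree n \<le> e * total_degree n" using e by simp
    also have "\<dots> \<le> T" using T n by simp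
    finally have "total_degree n \<le> T" .
    hence "mps_coeff (of_nat g * mps_subst e (mps_ghost (adams_sum X) c)) m = (\<Sum>i\<in>{1..T}. ?s i)"
      using e by (simp add: n mps_coeff_of_nat_mult mps_coeff_ghost_adams_sum[OF X c]
          sum_distrib_left del: of_nat_mult)
    \<comment> \<open>Terms with \<open>e * i > T\<close> vanish, since \<open>X\<close> has no constant term.\<close>
    also have "\<dots> = (\<Sum>i | i \<in> {1..T} \<and> e * i \<le> T. ?s i)"
    proof (rule sum.mono_neutral_right)
      show "\<forall>i\<in>{1..T} - {i. i \<in> {1..T} \<and> e * i \<le> T}. ?s i = 0"
      proof
        fix i assume i: "i \<in> {1..T} - {i. i \<in> {1..T} \<and> e * i \<le> T}"
        have "mps_subst i (mps_ghost X (i * c)) \<in> mps_fil (i * 1)"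
          by (intro fil_subst fil_ghost X)
        moreover have "total_degree n < i"
        proof -
          have "e * total_degree n \<le> T" using T n by simp
          also have "T < e * i" using i by auto
          finally show ?thesis by simp
        qed
        ultimately show "?s i = 0" by (simp add: mps_fil_def)
      qed
    qed auto
    also have "\<dots> = (\<Sum>j | j \<in> {1..T} \<and> e dvd j. ?t j)"
    proof (rule sum.reindex_bij_witness[of _ "\<lambda>j. j div e" "\<lambda>i. e * i"])
      fix i assume i: "i \<in> {i. i \<in> {1..T} \<and> e * i \<le> T}"
      have "e * i * k div d = i * c"
        using d by (simp add: dge kgc)
      moreover have "of_nat d / of_nat (e * i) = (of_nat g / of_nat i :: complex)"
        using e by (simp add: dge)
      ultimately show "?t (e * i) = ?s i"
        using i e by (simp add: n mps_coeff_subst_mult)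
    qed (use e in \<open>auto simp: Suc_le_eq div_greater_zero_iff dest: dvd_imp_le intro: le_trans[OF div_le_dividend]\<close>)
    finally show ?thesis .
  qed
  thus ?thesis by (simp add: dvd g_def e_def c_def)
qed

section \<open>Sums of Witt vectors and the integral\<close>

text \<open>
  Newton's identity relating power series coefficients and ghost components. It shows that the first
  \<open>n\<close> ghost components determine the first \<open>n\<close> coefficients, so that \<open>t\<close>-adic convergence of Witt
  vectors can be checked on ghost components.
\<close>

lemma witt_fps_rec:
  assumes "n > 0"
  shows "of_nat n * witt_fps w $ n = (\<Sum>i=1..n. ghost w i * witt_fps w $ (n - i))"
proof -
  have "witt_fps w * inverse (witt_fps w) = 1"
    by (metis inverse_mult_eq_1' witt_fps_0 zero_neq_one)
  hence "fps_ghost (witt_fps w) * witt_fps w = fps_X * fps_deriv (witt_fps w)"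
    by (simp add: fps_ghost_eq mult.assoc mult.left_commute mult.commute)
  hence "of_nat n * witt_fps w $ n = (fps_ghost (witt_fps w) * witt_fps w) $ n"
    using assms by (cases n) simp_all
  also have "\<dots> = (\<Sum>i=0..n. ghost w i * witt_fps w $ (n - i))"
    by (simp add: fps_mult_nth ghost_def)
  also have "\<dots> = (\<Sum>i=1..n. ghost w i * witt_fps w $ (n - i))"
    by (subst sum.atLeast_Suc_atMost) (simp_all add: ghost_def fps_ghost_def)
  finally show ?thesis .
qed

lemma witt_fps_nth_cong:
  assumes "\<And>i. i \<in> {1..n} \<Longrightarrow> ghost v i = ghost w i"
  shows "witt_fps v $ n = witt_fps w $ n"
  using assms
proof (induction n rule: less_induct)
  case (less n)
  show ?case
  proof (cases "n = 0")
    case False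
    have "(\<Sum>i=1..n. ghost v i * witt_fps v $ (n - i)) = (\<Sum>i=1..n. ghost w i * witt_fps w $ (n - i))"
      by (rule sum.cong) (use less in auto)
    hence "of_nat n * witt_fps v $ n = of_nat n * witt_fps w $ n"
      using False by (simp add: witt_fps_rec)
    thus ?thesis using False by simp
  qed simp
qed

lemma tendsto_wittI:
  assumes "\<And>n. n > 0 \<Longrightarrow> eventually (\<lambda>x. ghost (f x) n = ghost w n) net"
  shows "(f \<longlongrightarrow> w) net"
proof -
  have "((\<lambda>x. witt_fps (f x)) \<longlongrightarrow> witt_fps w) net"
    unfolding tendsto_fps_iff
  proof
    fix n
    have "\<forall>\<^sub>F x in net. \<forall>i\<in>{1..n}. ghost (f x) i = ghost w i"
      using assms by (intro eventually_ball_finite) auto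
    thus "\<forall>\<^sub>F x in net. witt_fps (f x) $ n = witt_fps w $ n"
      by (rule eventually_mono) (auto intro: witt_fps_nth_cong)
  qed
  thus ?thesis
    by (simp add: tendsto_iff dist_witt_def)
qed

lemma ghost_sum: "ghost (sum f A) k = (\<Sum>x\<in>A. ghost (f x) k)"
  by (induction A rule: infinite_finite_induct) simp_all

text \<open>
  The chain rule for \<open>t d/dt log\<close>.
\<close>

lemma ghost_witt_subst:
  assumes d: "d > 0"
  shows "ghost (witt_subst d w) n = (if d dvd n then of_nat d * ghost w (n div d) else 0)"
proof -
  let ?w = "witt_fps w"
  have X0: "(fps_X ^ d :: complex fps) $ 0 = 0" using d by simp
  have w0: "(?w oo fps_X ^ d) $ 0 = 1" by simp
  have XX: "fps_X * fps_deriv (fps_X ^ d) = (fps_const (of_nat d) * fps_X ^ d :: complex fps)"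
  proof (rule fps_ext)
    fix n show "(fps_X * fps_deriv (fps_X ^ d)) $ n = (fps_const (of_nat d) * fps_X ^ d :: complex fps) $ n"
      using d by (cases n) auto
  qed
  have "fps_ghost (?w oo fps_X ^ d)
      = fps_X * ((fps_deriv ?w oo fps_X ^ d) * fps_deriv (fps_X ^ d)) * inverse (?w oo fps_X ^ d)"
    unfolding fps_ghost_eq[OF w0] fps_compose_deriv[OF X0] ..
  also have "\<dots> = (fps_X * fps_deriv (fps_X ^ d)) * (fps_deriv ?w oo fps_X ^ d) * (inverse ?w oo fps_X ^ d)"
    using X0 by (simp add: fps_inverse_compose ac_simps del: fps_deriv_power)
  also have "\<dots> = fps_const (of_nat d) * (fps_X ^ d * (fps_deriv ?w oo fps_X ^ d) * (inverse ?w oo fps_X ^ d))"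
    by (simp only: XX mult.assoc)
  also have "\<dots> = fps_const (of_nat d) * (fps_ghost ?w oo fps_X ^ d)"
    using X0 by (simp add: fps_ghost_eq fps_compose_mult_distrib)
  finally show ?thesis
    using d w0 by (simp add: ghost_def witt_subst_def Abs_witt_inverse fps_nth_compose_X_power)
qed

section \<open>Orbits of admissible integer sets\<close>

lemma card_range_periodic:
  fixes f :: "int \<Rightarrow> 'v"
  assumes p: "p > 0" and f: "\<And>i j. f i = f j \<longleftrightarrow> int p dvd i - j"
  shows "card (range f) = p"
proof -
  have "f i \<in> f ` {0..<int p}" for i
  proof
    show "f i = f (i mod int p)" unfolding f by (metis dvd_minus_mod)
    show "i mod int p \<in> {0..<int p}" using p by simp
  qed
  hence "range f = f ` {0..<int p}" by auto
  moreover have "inj_on f {0..<int p}"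
  proof (rule inj_onI)
    fix i j assume ij: "i \<in> {0..<int p}" "j \<in> {0..<int p}" and "f i = f j"
    hence "i mod int p = j mod int p" unfolding f mod_eq_dvd_iff by simp
    moreover have "i mod int p = i" "j mod int p = j" using ij by simp_all
    ultimately show "i = j" by simp
  qed
  ultimately show ?thesis by (simp add: card_image)
qed

lemma orbit_integer_group: "orbit integer_group \<psi> v = range (\<lambda>i. \<psi> i v)"
  by (auto simp: orbit_def)

lemma at_orbit_eq: "x \<in> \<omega> \<Longrightarrow> (\<And>y. y \<in> \<omega> \<Longrightarrow> f y = c) \<Longrightarrow> at_orbit f \<omega> = c"
proof -
  assume "x \<in> \<omega>" "\<And>y. y \<in> \<omega> \<Longrightarrow> f y = c"
  hence "f ` \<omega> = {c}" by auto
  thus ?thesis by (simp add: at_orbit_def)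
qed

context admissible_zset
begin

lemma act_in: "v \<in> V \<Longrightarrow> \<phi> i v \<in> V"
  by (rule element_image[of i v]) auto

lemma act_add: "v \<in> V \<Longrightarrow> \<phi> (i + j) v = \<phi> i (\<phi> j v)"
  using composition_rule[of v i j] by simp

lemma act_0: "v \<in> V \<Longrightarrow> \<phi> 0 v = v"
  using id_eq_one by (metis one_integer_group restrict_apply')

lemma act_mult_fixed:
  assumes v: "v \<in> V" and i: "\<phi> i v = v"
  shows "\<phi> (j * i) v = v"
proof (induction j rule: int_induct[of _ 0])
  case base
  show ?case using v by (simp add: act_0)
next
  case (step1 j)
  thus ?case using act_add[OF v, of "j * i" i] i by (simp add: algebra_simps)
next
  case (step2 j)
  thus ?case using act_add[OF v, of "(j - 1) * i" i] i by (simp add: algebra_simps)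
qed

text \<open>
  The stabiliser of a point is a non-zero subgroup of the integers, generated by its least positive
  element; the orbit has that many elements.
\<close>

lemma zdeg:
  assumes v: "v \<in> V"
  shows zdeg_pos: "zdeg \<phi> v > 0"
    and act_eq_iff: "\<phi> i v = \<phi> j v \<longleftrightarrow> int (zdeg \<phi> v) dvd i - j"
proof -
  define p where "p = (LEAST p. p > 0 \<and> \<phi> (int p) v = v)"
  obtain k where "k \<ge> 1" "v \<in> zfixed V \<phi> k" using exhausted v by auto
  hence "k > 0 \<and> \<phi> (int k) v = v" by (auto simp: zfixed_def dest: spec[of _ 1])
  hence "p > 0 \<and> \<phi> (int p) v = v" unfolding p_def by (rule LeastI)
  hence p: "p > 0" "\<phi> (int p) v = v" by auto
  have least: "p \<le> n" if "n > 0" "\<phi> (int n) v = v" for n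
    unfolding p_def using that by (intro Least_le) auto
  have fixed: "\<phi> i v = v \<longleftrightarrow> int p dvd i" for i
  proof
    assume i: "\<phi> i v = v"
    have mod: "0 \<le> i mod int p" "i mod int p < int p" using p(1) by simp_all
    have "i mod int p = i + (- (i div int p)) * int p"
      by (simp add: minus_div_mult_eq_mod)
    hence "\<phi> (i mod int p) v = \<phi> i (\<phi> ((- (i div int p)) * int p) v)"
      by (simp only: act_add[OF v])
    also have "\<dots> = v" using i by (simp only: act_mult_fixed[OF v p(2)])
    finally have "\<phi> (int (nat (i mod int p))) v = v" using mod by simp
    hence "\<not> nat (i mod int p) > 0"
      using least[of "nat (i mod int p)"] mod by linarith
    hence "i mod int p = 0" using mod by simp
    thus "int p dvd i" by (rule mod_0_imp_dvd)
  next
    assume "int p dvd i"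
    thus "\<phi> i v = v" using act_mult_fixed[OF v p(2)] by (metis dvd_div_mult_self)
  qed
  have eq_iff: "\<phi> i v = \<phi> j v \<longleftrightarrow> int p dvd i - j" for i j
  proof -
    have "\<phi> i v = \<phi> j v \<longleftrightarrow> \<phi> (- j) (\<phi> i v) = \<phi> (- j) (\<phi> j v)"
      using inj_prop[of "- j"] act_in[OF v] by (auto dest: inj_onD)
    also have "\<dots> \<longleftrightarrow> \<phi> (i - j) v = v"
      using v by (simp add: act_0 flip: act_add)
    finally show ?thesis by (simp add: fixed)
  qed
  have "zdeg \<phi> v = p"
    unfolding orbit_integer_group by (rule card_range_periodic[OF p(1) eq_iff])
  thus "zdeg \<phi> v > 0" "\<phi> i v = \<phi> j v \<longleftrightarrow> int (zdeg \<phi> v) dvd i - j"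
    using p eq_iff by simp_all
qed

lemma zorbitsE:
  assumes "\<omega> \<in> zorbits V \<phi>"
  obtains v where "v \<in> V" "v \<in> \<omega>" "\<omega> = orbit integer_group \<phi> v"
  using assms orbit_refl by (auto simp: orbits_def)

lemma card_zorbit_pos: "\<omega> \<in> zorbits V \<phi> \<Longrightarrow> card \<omega> > 0"
  using zdeg_pos by (auto simp: orbits_def)

lemma orbit_eqI:
  assumes "v \<in> V" "x \<in> orbit integer_group \<phi> v"
  shows "orbit integer_group \<phi> x = orbit integer_group \<phi> v"
proof -
  have x: "x \<in> V" using assms act_in by (auto simp: orbit_integer_group)
  have "orbit integer_group \<phi> x \<in> zorbits V \<phi>" "orbit integer_group \<phi> v \<in> zorbits V \<phi>"
    using x assms by (auto simp: orbits_def)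
  with disjoint_union[of "orbit integer_group \<phi> x" "orbit integer_group \<phi> v"] orbit_refl[OF x] assms(2)
  show ?thesis by auto
qed

lemma finite_zorbits_card_le: "finite {\<omega> \<in> zorbits V \<phi>. card \<omega> \<le> D}"
proof (rule finite_subset)
  show "{\<omega> \<in> zorbits V \<phi>. card \<omega> \<le> D} \<subseteq> Pow (\<Union>d\<in>{1..D}. zfixed V \<phi> d)"
  proof safe
    fix \<omega> x assume \<omega>: "\<omega> \<in> zorbits V \<phi>" "card \<omega> \<le> D" and x: "x \<in> \<omega>"
    from \<omega>(1) obtain v where v: "v \<in> V" "\<omega> = orbit integer_group \<phi> v" by (rule zorbitsE)
    have xV: "x \<in> V" using v x act_in by (auto simp: orbit_integer_group)
    have "zdeg \<phi> x = card \<omega>" using orbit_eqI v x by simp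
    hence "\<phi> (int (card \<omega>) * j) x = \<phi> 0 x" for j
      by (simp add: act_eq_iff[OF xV])
    hence "x \<in> zfixed V \<phi> (card \<omega>)"
      using xV by (simp add: zfixed_def act_0)
    thus "x \<in> (\<Union>d\<in>{1..D}. zfixed V \<phi> d)"
      using \<omega> card_zorbit_pos[OF \<omega>(1)] by (intro UN_I[of "card \<omega>"]) auto
  qed
  show "finite (Pow (\<Union>d\<in>{1..D}. zfixed V \<phi> d))"
    using finite_fixed by simp
qed

text \<open>
  Only the finitely many orbits whose size divides \<open>n\<close> contribute to the \<open>n\<close>-th ghost component, which
  also proves that the sum defining the integral converges.
\<close>

lemma ghost_zintegral:
  assumes n: "n > 0"
  shows "ghost (zintegral V \<phi> f) n
    = (\<Sum>\<omega> | \<omega> \<in> zorbits V \<phi> \<and> card \<omega> dvd n. of_nat (card \<omega>) * ghost (at_orbit f \<omega>) (n div card \<omega>))"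
proof -
  define s where "s n \<omega> = of_nat (card \<omega>) * ghost (at_orbit f \<omega>) (n div card \<omega>)" for n and \<omega> :: "'v set"
  define D where "D n = {\<omega>. \<omega> \<in> zorbits V \<phi> \<and> card \<omega> dvd n}" for n
  define I where "I = witt_of_ghost (\<lambda>n. sum (s n) (D n))"
  have fin: "finite (D n)" if "n > 0" for n
    by (rule finite_subset[OF _ finite_zorbits_card_le[of n]])
      (use that in \<open>auto simp: D_def dest: dvd_imp_le\<close>)
  have "(sum (\<lambda>\<omega>. witt_subst (card \<omega>) (at_orbit f \<omega>)) \<longlongrightarrow> I) (finite_subsets_at_top (zorbits V \<phi>))"
  proof (rule tendsto_wittI)
    fix n :: nat assume n: "n > 0"
    have "\<forall>\<^sub>F X in finite_subsets_at_top (zorbits V \<phi>). finite X \<and> D n \<subseteq> X \<and> X \<subseteq> zorbits V \<phi>"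
      using fin[OF n] by (intro eventually_finite_subsets_at_top[THEN iffD2] exI[of _ "D n"])
        (auto simp: D_def)
    thus "\<forall>\<^sub>F X in finite_subsets_at_top (zorbits V \<phi>).
        ghost (\<Sum>\<omega>\<in>X. witt_subst (card \<omega>) (at_orbit f \<omega>)) n = ghost I n"
    proof (rule eventually_mono)
      fix X assume X: "finite X \<and> D n \<subseteq> X \<and> X \<subseteq> zorbits V \<phi>"
      have "ghost (\<Sum>\<omega>\<in>X. witt_subst (card \<omega>) (at_orbit f \<omega>)) n
          = (\<Sum>\<omega>\<in>X. if card \<omega> dvd n then s n \<omega> else 0)"
        unfolding ghost_sum using X card_zorbit_pos
        by (intro sum.cong) (auto simp: ghost_witt_subst s_def)
      also have "\<dots> = sum (s n) (D n)"
        using X by (intro sum.mono_neutral_cong_right) (auto simp: D_def)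
      finally show "ghost (\<Sum>\<omega>\<in>X. witt_subst (card \<omega>) (at_orbit f \<omega>)) n = ghost I n"
        using n by (simp add: I_def)
    qed
  qed
  hence "zintegral V \<phi> f = I"
    unfolding zintegral_def by (intro infsumI) (simp add: has_sum_def)
  thus ?thesis using n by (simp add: I_def s_def D_def)
qed

lemma at_orbit_zero: "\<omega> \<in> zorbits V \<phi> \<Longrightarrow> at_orbit 0 \<omega> = 0"
  by (erule zorbitsE) (auto intro!: at_orbit_eq)

lemma fil_zintegral: "L \<in> mps_fil N \<Longrightarrow> mps_map (zintegral V \<phi>) L \<in> mps_fil N"
  by (rule fil_map) (auto intro!: witt_eqI sum.neutral simp: ghost_zintegral at_orbit_zero)

lemma fil_at_orbit: "\<omega> \<in> zorbits V \<phi> \<Longrightarrow> L \<in> mps_fil N \<Longrightarrow> mps_at_orbit L \<omega> \<in> mps_fil N"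
  by (rule fil_map) (auto simp: at_orbit_zero)

text \<open>
  The logarithm of \<open>H(\<omega>)\<^bsub>k/g\<^esub>(t\<^bsup>d/g\<^esup>)\<close> for \<open>L\<close> the plethystic logarithm of \<open>H\<close>, where \<open>d\<close> is the
  size of the orbit \<open>\<omega>\<close> and \<open>g = gcd k d\<close>.
\<close>

definition orbit_log :: "nat \<Rightarrow> ('v \<Rightarrow> witt) mps \<Rightarrow> 'v set \<Rightarrow> complex mps" where
  "orbit_log k L \<omega> = mps_subst (card \<omega> div gcd k (card \<omega>))
     (mps_ghost (adams_sum (mps_at_orbit L \<omega>)) (k div gcd k (card \<omega>)))"

text \<open>
  The additive form of the product formula. The \<open>k\<close>-th ghost component turns the \<open>j\<close>-th Adams
  operation into the ghost index \<open>j * k\<close>, where orbits of size dividing \<open>j * k\<close> contribute;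
  exchanging the sums over \<open>j\<close> and over orbits leaves one orbit logarithm per orbit. For coefficients
  of degree at most \<open>N\<close> only \<open>j \<le> N\<close> matters, hence only orbits of size at most \<open>N * k\<close>.
\<close>

lemma ghost_adams_sum_zintegral:
  assumes L: "L \<in> mps_fil 1" and k: "k > 0"
  shows "mps_ghost (adams_sum (mps_map (zintegral V \<phi>) L)) k
    - (\<Sum>\<omega> | \<omega> \<in> zorbits V \<phi> \<and> card \<omega> \<le> N * k. of_nat (gcd k (card \<omega>)) * orbit_log k L \<omega>)
    \<in> mps_fil (Suc N)"
proof -
  let ?S = "{\<omega>. \<omega> \<in> zorbits V \<phi> \<and> card \<omega> \<le> N * k}"
  have finS: "finite ?S" by (rule finite_zorbits_card_le)
  define t where "t m j \<omega> = of_nat (card \<omega>) / of_nat j *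
    mps_coeff (mps_subst j (mps_ghost (mps_at_orbit L \<omega>) (j * k div card \<omega>))) m" for m j \<omega>
  have "mps_coeff (mps_ghost (adams_sum (mps_map (zintegral V \<phi>) L)) k) m
      = mps_coeff (\<Sum>\<omega>\<in>?S. of_nat (gcd k (card \<omega>)) * orbit_log k L \<omega>) m"
    if m: "total_degree m < Suc N" for m
  proof -
    have "mps_coeff (mps_subst j (mps_ghost (mps_map (zintegral V \<phi>) L) (j * k))) m / of_nat j
        = (\<Sum>\<omega> | \<omega> \<in> ?S \<and> card \<omega> dvd j * k. t m j \<omega>)" if j: "j \<in> {1..N}" for j
    proof -
      interpret filtered_hom "mps_subst j :: complex mps \<Rightarrow> complex mps"
        by (rule filtered_hom_subst) (use j in simp)
      have jk: "0 < j * k" "j * k \<le> N * k" using j k by auto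
      hence S: "{\<omega>. \<omega> \<in> zorbits V \<phi> \<and> card \<omega> dvd j * k} = {\<omega>. \<omega> \<in> ?S \<and> card \<omega> dvd j * k}"
        using le_trans[OF dvd_imp_le[OF _ jk(1)] jk(2)] by auto
      have "mps_ghost (mps_map (zintegral V \<phi>) L) (j * k)
        = (\<Sum>\<omega> | \<omega> \<in> ?S \<and> card \<omega> dvd j * k.
            of_nat (card \<omega>) * mps_ghost (mps_at_orbit L \<omega>) (j * k div card \<omega>))"
        by (rule mps_eqI)
          (use jk in \<open>simp add: mps_ghost_def ghost_zintegral S mps_coeff_sum mps_coeff_of_nat_mult\<close>)
      thus ?thesis
        by (simp add: hom_sum hom_mult hom_of_nat mps_coeff_sum mps_coeff_of_nat_mult t_def
            sum_divide_distrib)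
    qed
    hence "mps_coeff (mps_ghost (adams_sum (mps_map (zintegral V \<phi>) L)) k) m
        = (\<Sum>j\<in>{1..N}. \<Sum>\<omega> | \<omega> \<in> ?S \<and> card \<omega> dvd j * k. t m j \<omega>)"
      using m by (simp add: mps_coeff_ghost_adams_sum[OF fil_zintegral[OF L] k, of m N] del: mem_Collect_eq)
    also have "\<dots> = (\<Sum>\<omega>\<in>?S. \<Sum>j | j \<in> {1..N} \<and> card \<omega> dvd j * k. t m j \<omega>)"
      using finS by (intro sum.swap_restrict) auto
    also have "\<dots> = (\<Sum>\<omega>\<in>?S. mps_coeff (of_nat (gcd k (card \<omega>)) * orbit_log k L \<omega>) m)"
    proof (rule sum.cong[OF refl])
      fix \<omega> assume "\<omega> \<in> ?S"
      hence \<omega>: "\<omega> \<in> zorbits V \<phi>" by simp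
      show "(\<Sum>j | j \<in> {1..N} \<and> card \<omega> dvd j * k. t m j \<omega>)
          = mps_coeff (of_nat (gcd k (card \<omega>)) * orbit_log k L \<omega>) m"
        unfolding orbit_log_def t_def
        by (rule mps_coeff_orbit_log[symmetric]) (use m k \<omega> L in \<open>auto simp: card_zorbit_pos fil_at_orbit\<close>)
    qed
    finally show ?thesis by (simp only: mps_coeff_sum)
  qed
  thus ?thesis by (simp add: mps_fil_def)
qed

lemma mps_at_orbit_eval:
  assumes "F \<in> mps_over (orbit_funs V \<phi>)" "v \<in> V"
  shows "mps_at_orbit F (orbit integer_group \<phi> v) = mps_map (\<lambda>f. f v) F"
proof (rule mps_eqI)
  fix m
  have "mps_coeff F m \<in> orbit_funs V \<phi>" using assms by (simp add: mps_over_def)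
  hence "at_orbit (mps_coeff F m) (orbit integer_group \<phi> v) = mps_coeff F m v"
    using assms(2) by (intro at_orbit_eq[OF orbit_refl]) (auto simp: orbit_funs_def orbit_integer_group)
  thus "mps_coeff (mps_at_orbit F (orbit integer_group \<phi> v)) m = mps_coeff (mps_map (\<lambda>f. f v) F) m"
    by simp
qed

text \<open>
  Evaluation at two points of one orbit gives two plethystic logarithms of the same series, which
  coincide by injectivity. This is needed because \<open>Log_sigma\<close> inverts the exponential over all
  functions on the ambient type.
\<close>

lemma Log_sigma_over_orbit_funs:
  assumes H: "H - 1 \<in> mps_fil 1" "H \<in> mps_over (orbit_funs V \<phi>)"
  shows "Log_sigma H \<in> mps_over (orbit_funs V \<phi>)"
proof -
  let ?L = "Log_sigma H"
  have "mps_coeff ?L m (\<phi> j v) = mps_coeff ?L m v" if v: "v \<in> V" for m j v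
  proof -
    have fil: "mps_map (\<lambda>f. f x) ?L \<in> mps_fil 1" for x
      by (rule fil_map[OF _ Log_sigma(1)[OF H(1)]]) simp
    have Exp: "Exp_sigma (mps_map (\<lambda>f. f x) ?L) = mps_map (\<lambda>f. f x) H" for x
      unfolding eval_Exp_sigma[OF Log_sigma(1)[OF H(1)], symmetric] Log_sigma(2)[OF H(1)] ..
    have "mps_map (\<lambda>f. f (\<phi> j v)) H = mps_map (\<lambda>f. f v) H"
    proof (rule mps_eqI)
      fix m
      have "mps_coeff H m \<in> orbit_funs V \<phi>" using H(2) by (simp add: mps_over_def)
      thus "mps_coeff (mps_map (\<lambda>f. f (\<phi> j v)) H) m = mps_coeff (mps_map (\<lambda>f. f v) H) m"
        using v by (simp add: orbit_funs_def)
    qed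
    hence "mps_map (\<lambda>f. f (\<phi> j v)) ?L = mps_map (\<lambda>f. f v) ?L"
      by (intro Exp_sigma_inject[OF fil fil] trans[OF Exp trans[OF _ Exp[symmetric]]])
    hence "mps_coeff (mps_map (\<lambda>f. f (\<phi> j v)) ?L) m = mps_coeff (mps_map (\<lambda>f. f v) ?L) m"
      by (simp only:)
    thus ?thesis by (simp only: mps_coeff_map)
  qed
  thus ?thesis by (simp add: mps_over_def orbit_funs_def)
qed

lemma Exp_sigma_at_orbit:
  assumes H: "H - 1 \<in> mps_fil 1" "H \<in> mps_over (orbit_funs V \<phi>)" and \<omega>: "\<omega> \<in> zorbits V \<phi>"
  shows "Exp_sigma (mps_at_orbit (Log_sigma H) \<omega>) = mps_at_orbit H \<omega>"
  using \<omega>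
proof (rule zorbitsE)
  fix v assume "v \<in> V" "\<omega> = orbit integer_group \<phi> v"
  thus ?thesis
    using eval_Exp_sigma[OF Log_sigma(1)[OF H(1)], of v] Log_sigma(2)[OF H(1)]
    by (simp add: mps_at_orbit_eval[OF H(2)] mps_at_orbit_eval[OF Log_sigma_over_orbit_funs[OF H]])
qed

section \<open>Splitting orbits\<close>

lemma group_action_zscale: "group_action integer_group V (zscale k \<phi>)"
proof -
  interpret gh: group_hom integer_group "BijGroup V" \<phi> by (rule group_hom)
  have "group_hom integer_group (BijGroup V) (zscale k \<phi>)"
  proof (rule group_hom.intro[OF group_integer_group group_BijGroup group_hom_axioms.intro[OF homI]])
    show "zscale k \<phi> x \<in> carrier (BijGroup V)" for x
      unfolding zscale_def by (rule gh.hom_closed) simp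
    show "zscale k \<phi> (x \<otimes>\<^bsub>integer_group\<^esub> y) = zscale k \<phi> x \<otimes>\<^bsub>BijGroup V\<^esub> zscale k \<phi> y" for x y
      unfolding zscale_def using gh.hom_mult[of "int k * x" "int k * y"] by (simp add: distrib_left)
  qed
  thus ?thesis by (rule group_action.intro)
qed

lemma zdeg_zscale:
  assumes "v \<in> V"
  shows "zdeg (zscale k \<phi>) v = zdeg \<phi> v div gcd k (zdeg \<phi> v)"
  unfolding orbit_integer_group[of "zscale k \<phi>"]
proof (rule card_range_periodic)
  show "0 < zdeg \<phi> v div gcd k (zdeg \<phi> v)"
    using zdeg_pos[OF assms] by (simp add: div_greater_zero_iff gcd_le2_nat)
  show "zscale k \<phi> i v = zscale k \<phi> j v \<longleftrightarrow> int (zdeg \<phi> v div gcd k (zdeg \<phi> v)) dvd i - j" for i j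
    using dvd_mult_iff_div_gcd[OF zdeg_pos[OF assms], of k "i - j"]
    by (simp add: zscale_def act_eq_iff[OF assms] right_diff_distrib)
qed

text \<open>
  The orbits of the action multiplied by \<open>k\<close> into which a given orbit breaks up.
\<close>

definition orbit_parts :: "nat \<Rightarrow> 'v set \<Rightarrow> 'v set set" where
  "orbit_parts k \<omega> = orbit integer_group (zscale k \<phi>) ` \<omega>"

lemma zorbits_zscale: "zorbits V (zscale k \<phi>) = (\<Union>\<omega>\<in>zorbits V \<phi>. orbit_parts k \<omega>)"
proof -
  have "V = \<Union> (zorbits V \<phi>)" using orbits_coverture by simp
  thus ?thesis unfolding orbit_parts_def by (subst orbits_def) blast
qed

text \<open>
  Every part has \<open>card \<omega> div gcd k (card \<omega>)\<close> elements, and the parts partition \<open>\<omega>\<close>; counting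
  elements gives the number of parts.
\<close>

lemma orbit_parts:
  assumes \<omega>: "\<omega> \<in> zorbits V \<phi>"
  shows card_orbit_part: "\<rho> \<in> orbit_parts k \<omega> \<Longrightarrow> card \<rho> = card \<omega> div gcd k (card \<omega>)"
    and Union_orbit_parts: "\<Union> (orbit_parts k \<omega>) = \<omega>"
    and card_orbit_parts: "card (orbit_parts k \<omega>) = gcd k (card \<omega>)"
    and finite_orbit_parts: "finite (orbit_parts k \<omega>)"
proof -
  interpret Z: group_action integer_group V "zscale k \<phi>" by (rule group_action_zscale)
  obtain v where v: "v \<in> V" "\<omega> = orbit integer_group \<phi> v" using \<omega> by (rule zorbitsE)
  have \<omega>V: "x \<in> V" "orbit integer_group \<phi> x = \<omega>" if "x \<in> \<omega>" for x
    using that v act_in orbit_eqI by (auto simp: orbit_integer_group)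
  show card: "card \<rho> = card \<omega> div gcd k (card \<omega>)" if "\<rho> \<in> orbit_parts k \<omega>" for \<rho>
    using that \<omega>V by (auto simp: orbit_parts_def zdeg_zscale)
  show U: "\<Union> (orbit_parts k \<omega>) = \<omega>"
  proof
    have "orbit integer_group (zscale k \<phi>) x \<subseteq> orbit integer_group \<phi> x" for x
      by (auto simp: orbit_integer_group zscale_def)
    thus "\<Union> (orbit_parts k \<omega>) \<subseteq> \<omega>" using \<omega>V by (fastforce simp: orbit_parts_def)
    show "\<omega> \<subseteq> \<Union> (orbit_parts k \<omega>)" using \<omega>V Z.orbit_refl by (auto simp: orbit_parts_def)
  qed
  have pos: "card \<omega> > 0" by (rule card_zorbit_pos[OF \<omega>])
  hence fin\<omega>: "finite \<omega>" by (rule card_ge_0_finite)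
  show fin: "finite (orbit_parts k \<omega>)" unfolding orbit_parts_def using fin\<omega> by simp
  have "card \<omega> div gcd k (card \<omega>) * card (orbit_parts k \<omega>) = card (\<Union> (orbit_parts k \<omega>))"
  proof (rule card_partition)
    fix \<rho> \<sigma> assume "\<rho> \<in> orbit_parts k \<omega>" "\<sigma> \<in> orbit_parts k \<omega>" "\<rho> \<noteq> \<sigma>"
    thus "\<rho> \<inter> \<sigma> = {}"
      using Z.disjoint_union[of \<rho> \<sigma>] zorbits_zscale \<omega> by blast
  qed (use fin fin\<omega> U card in auto)
  also have "\<dots> = card \<omega> div gcd k (card \<omega>) * gcd k (card \<omega>)" by (simp add: U)
  finally have "card \<omega> div gcd k (card \<omega>) * card (orbit_parts k \<omega>)
      = card \<omega> div gcd k (card \<omega>) * gcd k (card \<omega>)" .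
  moreover have "card \<omega> div gcd k (card \<omega>) > 0"
    using pos by (simp add: div_greater_zero_iff gcd_le2_nat)
  ultimately show "card (orbit_parts k \<omega>) = gcd k (card \<omega>)"
    by (metis nat_mult_eq_cancel1)
qed

lemma orbit_parts_disjoint:
  assumes "\<omega> \<in> zorbits V \<phi>" "\<omega>' \<in> zorbits V \<phi>" "\<omega> \<noteq> \<omega>'"
  shows "orbit_parts k \<omega> \<inter> orbit_parts k \<omega>' = {}"
proof -
  have False if "\<rho> \<in> orbit_parts k \<omega>" "\<rho> \<in> orbit_parts k \<omega>'" for \<rho>
  proof -
    have "\<rho> \<subseteq> \<omega>" "\<rho> \<subseteq> \<omega>'" using that Union_orbit_parts assms by blast+
    moreover have "\<rho> \<noteq> {}"
      using that(1) by (auto simp: orbit_parts_def orbit_integer_group)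
    ultimately show False using disjoint_union[OF assms(1,2)] assms(3) by blast
  qed
  thus ?thesis by blast
qed

text \<open>
  All parts of an orbit carry the same factor: the Adams operation built into the restriction moves
  ghost index \<open>1\<close> to \<open>k div gcd k (card \<omega>)\<close>.
\<close>

lemma mps_ghost_zrestrict_at_part:
  assumes H: "H \<in> mps_over (orbit_funs V \<phi>)" and \<omega>: "\<omega> \<in> zorbits V \<phi>" and \<rho>: "\<rho> \<in> orbit_parts k \<omega>"
  shows "mps_ghost (mps_at_orbit (mps_map (zrestrict k \<phi>) H) \<rho>) 1
    = mps_ghost (mps_at_orbit H \<omega>) (k div gcd k (card \<omega>))"
proof (rule mps_eqI)
  fix m
  let ?f = "mps_coeff H m"
  obtain v where v: "v \<in> V" "\<omega> = orbit integer_group \<phi> v" "v \<in> \<omega>" using \<omega> by (rule zorbitsE)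
  have f: "?f \<in> orbit_funs V \<phi>" using H by (simp add: mps_over_def)
  have fx: "?f x = ?f v" "zdeg \<phi> x = card \<omega>" if x: "x \<in> \<omega>" for x
  proof -
    obtain i where "x = \<phi> i v" using x v(2) by (auto simp: orbit_integer_group)
    thus "?f x = ?f v" using f v(1) by (simp add: orbit_funs_def)
    show "zdeg \<phi> x = card \<omega>" using orbit_eqI[OF v(1)] x v(2) by simp
  qed
  have \<rho>\<omega>: "\<rho> \<subseteq> \<omega>" using \<rho> Union_orbit_parts[OF \<omega>] by blast
  obtain x where x: "x \<in> \<rho>" using \<rho> by (auto simp: orbit_parts_def orbit_integer_group)
  have "at_orbit ?f \<omega> = ?f v" using v fx by (intro at_orbit_eq)
  moreover have "at_orbit (zrestrict k \<phi> ?f) \<rho> = adams (k div gcd k (card \<omega>)) (?f v)"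
    using x by (rule at_orbit_eq) (use fx \<rho>\<omega> in \<open>auto simp: zrestrict_def gcd.commute\<close>)
  ultimately show "mps_coeff (mps_ghost (mps_at_orbit (mps_map (zrestrict k \<phi>) H) \<rho>) 1) m
      = mps_coeff (mps_ghost (mps_at_orbit H \<omega>) (k div gcd k (card \<omega>))) m"
    by (simp add: mps_ghost_def)
qed

end

section \<open>The product formula\<close>

theorem proposition3p2p1:
  fixes V :: "'v set" and \<phi> :: "int \<Rightarrow> 'v \<Rightarrow> 'v"
    and H :: "('v \<Rightarrow> witt) mps" and k :: nat
  assumes "admissible_zset V \<phi>"
    and "H \<in> (+) 1 ` (Fil1 \<inter> mps_over (orbit_funs V \<phi>))"
    and "k \<ge> 1"
  shows "has_mps_prod
           (\<lambda>\<omega>. mps_subst (card \<omega>)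
              (mps_ghost (mps_at_orbit (mps_map (zrestrict k \<phi>) H) \<omega>) 1))
           (zorbits V (zscale k \<phi>))
           (mps_ghost (euler_product V \<phi> H) k)
       \<and> has_mps_prod
           (\<lambda>\<omega>. mps_subst (card \<omega> div gcd k (card \<omega>))
              (mps_ghost (mps_at_orbit H \<omega>) (k div gcd k (card \<omega>))) ^ gcd k (card \<omega>))
           (zorbits V \<phi>)
           (mps_ghost (euler_product V \<phi> H) k)"
proof -
  interpret admissible_zset V \<phi> by fact
  have k: "k > 0" using assms(3) by simp
  have H1: "H - 1 \<in> mps_fil 1" using assms(2) by (auto simp: Fil1_eq)
  have HV: "H \<in> mps_over (orbit_funs V \<phi>)"
    using assms(2) by (auto simp: mps_over_def orbit_funs_def plus_fun_def one_fun_def zero_fun_def)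
  define L where "L = Log_sigma H"
  have L: "L \<in> mps_fil 1" using Log_sigma(1)[OF H1] by (simp add: L_def)
  define P where "P = mps_ghost (euler_product V \<phi> H) k"
  define B where "B = mps_ghost (adams_sum (mps_map (zintegral V \<phi>) L)) k"
  define E where "E \<omega> = mps_subst (card \<omega> div gcd k (card \<omega>))
      (mps_ghost (mps_at_orbit H \<omega>) (k div gcd k (card \<omega>)))" for \<omega>
  define S where "S N = {\<omega>. \<omega> \<in> zorbits V \<phi> \<and> card \<omega> \<le> N * k}" for N
  have B: "B \<in> mps_fil 1"
    unfolding B_def by (intro fil_ghost fil_adams_sum fil_zintegral L) simp
  have P: "P = mps_exp B"
    unfolding P_def euler_product_def B_def L_def[symmetric] Exp_sigma_eq
    by (intro filtered_hom.hom_exp[OF filtered_hom_ghost[OF k]] fil_adams_sum fil_zintegral L) simp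
  have log: "orbit_log k L \<omega> \<in> mps_fil (card \<omega> div gcd k (card \<omega>))" if "\<omega> \<in> zorbits V \<phi>" for \<omega>
    using fil_subst[OF fil_ghost[OF fil_adams_sum[OF fil_at_orbit[OF that L]]], of "card \<omega> div gcd k (card \<omega>)"]
    by (simp add: orbit_log_def)
  have e: "card \<omega> div gcd k (card \<omega>) > 0" if "\<omega> \<in> zorbits V \<phi>" for \<omega>
    using card_zorbit_pos[OF that] by (simp add: div_greater_zero_iff gcd_le2_nat)
  have log1: "orbit_log k L \<omega> \<in> mps_fil 1" if "\<omega> \<in> zorbits V \<phi>" for \<omega>
    using fil_mono[OF log[OF that]] e[OF that] by simp
  have E: "E \<omega> = mps_exp (orbit_log k L \<omega>)" if \<omega>: "\<omega> \<in> zorbits V \<phi>" for \<omega>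
  proof -
    have A: "adams_sum (mps_at_orbit L \<omega>) \<in> mps_fil 1"
      by (intro fil_adams_sum fil_at_orbit \<omega> L) simp
    have c: "k div gcd k (card \<omega>) > 0"
      using k by (simp add: div_greater_zero_iff gcd_le1_nat)
    show ?thesis
      using filtered_hom.hom_exp[OF filtered_hom_ghost[OF c] A]
        filtered_hom.hom_exp[OF filtered_hom_subst[OF e[OF \<omega>]] fil_ghost[OF A]]
      unfolding E_def orbit_log_def Exp_sigma_at_orbit[OF H1 HV \<omega>, symmetric] L_def[symmetric] Exp_sigma_eq
      by simp
  qed
  \<comment> \<open>The orbit logarithm has order at least \<open>card \<omega> div gcd k (card \<omega>)\<close>, which exceeds \<open>N\<close>
    once \<open>card \<omega> > N * k\<close>, because the divisor is at most \<open>k\<close>.\<close>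
  have E_far: "E \<omega> - 1 \<in> mps_fil (Suc N)" if \<omega>: "\<omega> \<in> zorbits V \<phi>" "\<omega> \<notin> S N" for N \<omega>
  proof -
    have "N * gcd k (card \<omega>) \<le> N * k" using k by (simp add: gcd_le1_nat)
    also have "\<dots> < card \<omega>" using that by (simp add: S_def)
    also have "\<dots> = card \<omega> div gcd k (card \<omega>) * gcd k (card \<omega>)" by simp
    finally have "N < card \<omega> div gcd k (card \<omega>)" by (simp only: mult_less_cancel2)
    hence "orbit_log k L \<omega> \<in> mps_fil (Suc N)" by (intro fil_mono[OF log[OF \<omega>(1)]]) simp
    thus ?thesis
      using mps_exp_cong_fil[of "orbit_log k L \<omega>" 0 "Suc N"] log1[OF \<omega>(1)] by (simp add: E \<omega>)
  qed
  have E_near: "(\<Prod>\<omega>\<in>S N. E \<omega> ^ gcd k (card \<omega>)) - P \<in> mps_fil (Suc N)" for N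
  proof -
    let ?l = "\<lambda>\<omega>. of_nat (gcd k (card \<omega>)) * orbit_log k L \<omega>"
    have l: "?l \<omega> \<in> mps_fil 1" if "\<omega> \<in> S N" for \<omega>
      using log1 that by (intro fil_mult_left) (simp add: S_def)
    have "(\<Prod>\<omega>\<in>S N. E \<omega> ^ gcd k (card \<omega>)) = (\<Prod>\<omega>\<in>S N. mps_exp (?l \<omega>))"
      using log1 by (intro prod.cong) (auto simp: S_def E mps_exp_of_nat_mult)
    also have "\<dots> = mps_exp (sum ?l (S N))"
      by (rule mps_exp_sum[symmetric]) (rule l)
    finally show ?thesis
      unfolding P using ghost_adams_sum_zintegral[OF L k, of N]
      by (simp only:) (intro mps_exp_cong_fil fil_sum l B fil_diff_sym[of B]; simp add: B_def S_def)
  qed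
  have finS: "finite (S N)" for N
    unfolding S_def by (rule finite_zorbits_card_le)
  have S_sub: "S N \<subseteq> zorbits V \<phi>" for N by (auto simp: S_def)
  have "has_mps_prod (\<lambda>\<omega>. E \<omega> ^ gcd k (card \<omega>)) (zorbits V \<phi>) P"
  proof (rule has_mps_prod_fil, intro exI conjI ballI)
    fix N
    show "(\<Prod>\<omega>\<in>S N. E \<omega> ^ gcd k (card \<omega>)) - P \<in> mps_fil N"
      by (rule fil_mono[OF E_near]) simp
    fix \<omega> assume "\<omega> \<in> zorbits V \<phi> - S N"
    hence "E \<omega> - 1 \<in> mps_fil N" using fil_mono[OF E_far[of \<omega> N], of N] by simp
    thus "E \<omega> ^ gcd k (card \<omega>) - 1 \<in> mps_fil N"
      using fil_prod_1[of "{..<gcd k (card \<omega>)}" "\<lambda>_. E \<omega>" N] by simp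
  qed (use finS S_sub in auto)
  moreover have "has_mps_prod (\<lambda>\<rho>. mps_subst (card \<rho>)
      (mps_ghost (mps_at_orbit (mps_map (zrestrict k \<phi>) H) \<rho>) 1)) (zorbits V (zscale k \<phi>)) P"
    (is "has_mps_prod ?F _ _")
  proof (rule has_mps_prod_fil, intro exI conjI ballI)
    fix N
    have F: "?F \<rho> = E \<omega>" if "\<omega> \<in> zorbits V \<phi>" "\<rho> \<in> orbit_parts k \<omega>" for \<omega> \<rho>
      using mps_ghost_zrestrict_at_part[OF HV that] card_orbit_part[OF that] by (simp add: E_def)
    \<comment> \<open>The relevant factors over the finer orbits are the parts of the orbits in \<open>S N\<close>. Each orbit
      contributes \<open>gcd k (card \<omega>)\<close> equal factors, which gives the product already computed.\<close>
    let ?R = "\<Union>\<omega>\<in>S N. orbit_parts k \<omega>"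
    show "finite ?R" using finS S_sub finite_orbit_parts by blast
    show "?R \<subseteq> zorbits V (zscale k \<phi>)" using S_sub by (auto simp: zorbits_zscale)
    have "prod ?F ?R = (\<Prod>\<omega>\<in>S N. prod ?F (orbit_parts k \<omega>))"
      using finS S_sub finite_orbit_parts orbit_parts_disjoint
      by (intro prod.UNION_disjoint ballI impI) blast+
    also have "\<dots> = (\<Prod>\<omega>\<in>S N. E \<omega> ^ gcd k (card \<omega>))"
    proof (rule prod.cong[OF refl])
      fix \<omega> assume "\<omega> \<in> S N"
      hence \<omega>: "\<omega> \<in> zorbits V \<phi>" using S_sub by blast
      have "prod ?F (orbit_parts k \<omega>) = prod (\<lambda>_. E \<omega>) (orbit_parts k \<omega>)"
        using F[OF \<omega>] by (intro prod.cong) auto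
      thus "prod ?F (orbit_parts k \<omega>) = E \<omega> ^ gcd k (card \<omega>)"
        by (simp add: card_orbit_parts[OF \<omega>])
    qed
    finally show "prod ?F ?R - P \<in> mps_fil N"
      using fil_mono[OF E_near, of N N] by simp
    fix \<rho> assume \<rho>: "\<rho> \<in> zorbits V (zscale k \<phi>) - ?R"
    then obtain \<omega> where \<omega>: "\<omega> \<in> zorbits V \<phi>" "\<rho> \<in> orbit_parts k \<omega>" by (auto simp: zorbits_zscale)
    with \<rho> have "\<omega> \<notin> S N" by blast
    thus "?F \<rho> - 1 \<in> mps_fil N"
      unfolding F[OF \<omega>] using fil_mono[OF E_far[OF \<omega>(1)], of N N] by simp
  qed
  ultimately show ?thesis by (simp add: E_def P_def)
qed

end
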